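(* Let $N,T,K\in\mathbb N$, let $X_1,\dots,X_K,\Gamma,E$ be random matrices in $\mathcal M_{NT}$ (with arbitrary joint distribution), $\beta\in\mathbb R^K$, and $Y=\sum_{k=1}^K\beta_kX_k+\Gamma+E$. Let $\lambda>0$, let $(\widehat\beta,\widehat\Gamma)$ be any solution of $$\min_{b\in\mathbb R^K,\ G\in\mathcal M_{NT}}\ \frac1{\sqrt{NT}}\Big|Y-\sum_{k=1}^Kb_kX_k-G\Big|_2+\frac{\lambda}{NT}|G|_*,$$ and let $\widehat\sigma=\frac1{\sqrt{NT}}\big|Y-\sum_{k=1}^K\widehat\beta_kX_k-\widehat\Gamma\big|_2$. Let $\rho\in(0,1)$. Then, on the event $$\mathcal E=\left\{\rho\lambda\frac{|M_X(E)|_2}{\sqrt{NT}}\ge|M_X(E)|_{\mathrm{op}}\right\},$$ we have $$|\widehat\Gamma-\Gamma|_*\le2\,\theta_*(\rho)\qquad\text{and}\qquad\left|\widehat\sigma-\frac{|M_X(E)|_2}{\sqrt{NT}}\right|\le\frac{2\lambda}{NT}\,\theta_\sigma(\rho),$$ where $\theta_*(\rho)$ and $\theta_\sigma(\rho)$ are defined in the context.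
   Context: $\mathcal M_{NT}$ is the set of real $N\times T$ matrices; $|A|_2$, $|A|_*$, $|A|_{\mathrm{op}}$ are the Frobenius, nuclear and operator norms. $M_X:\mathcal M_{NT}\to\mathcal M_{NT}$ is the orthogonal projector (for $\langle A,B\rangle=\mathrm{tr}(A^\top B)$) onto the orthogonal complement of $\mathrm{span}\{X_1,\dots,X_K\}$. For $A\in\mathcal M_{NT}$, $M_{u(A)}$ (resp. $M_{v(A)}$) is the orthogonal projector of $\mathbb R^N$ (resp. $\mathbb R^T$) onto the orthogonal complement of the column space (resp. row space) of $A$. For $\Delta\in\mathcal M_{NT}$, $\mathcal P_A^\perp(\Delta)=M_{u(A)}\Delta M_{v(A)}$ and $\mathcal P_A(\Delta)=\Delta-\mathcal P_A^\perp(\Delta)$. For $c>0$, the cone is $C_{A,c}=\{\Delta\in\mathcal M_{NT}:\ |\mathcal P_A^\perp(\Delta)|_*\le c\,|\mathcal P_A(\Delta)|_*\}$, and the compatibility constant is $$\kappa_{A,c}=\inf_{\Delta\in C_{A,c}:\ \Delta\neq0}\frac{\sqrt{2\,\mathrm{rank}(A)}\,|M_X(\Delta)|_2}{|\mathcal P_A(\Delta)|_*}$$ (infimum over the empty set is $+\infty$, which is the case when $A=0$). For $\rho\in(0,1)$ and $\widetilde\rho>0$: $$c(\rho,\widetilde\rho)=\frac{1+\rho+\widetilde\rho}{1-\rho},\quad d(\rho,\widetilde\rho)=\max\big(1+\widetilde\rho,\ \rho(1+c(\rho,\widetilde\rho))\big),\quad e(\rho,\widetilde\rho)=d(\rho,\widetilde\rho)+\rho(1+c(\rho,\widetilde\rho)),$$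 $$\theta_\infty(\widetilde\Gamma,\rho,\widetilde\rho)=2\left(1-\left(\frac{d(\rho,\widetilde\rho)\sqrt{2\,\mathrm{rank}(\widetilde\Gamma)}\,\lambda}{\sqrt{NT}\,\kappa_{\widetilde\Gamma,c(\rho,\widetilde\rho)}}\right)^2\right)_+^{-1}e(\rho,\widetilde\rho),$$ $$\theta(\rho,\widetilde\rho)=\inf_{\widetilde\Gamma\in\mathcal M_{NT}}\max\left(\theta_\infty(\widetilde\Gamma,\rho,\widetilde\rho)\,\frac{\lambda\,\mathrm{rank}(\widetilde\Gamma)\,|M_X(E)|_2}{\sqrt{NT}\,\kappa_{\widetilde\Gamma,c(\rho,\widetilde\rho)}^2},\ \frac1{\widetilde\rho}|\Gamma-\widetilde\Gamma|_*\right),$$ $$\theta_*(\rho)=\inf_{\widetilde\rho>0}(1+c(\rho,\widetilde\rho))\,\theta(\rho,\widetilde\rho),\qquad\theta_\sigma(\rho)=\inf_{\widetilde\rho>0}d(\rho,\widetilde\rho)\,\theta(\rho,\widetilde\rho).$$ Here $a_+=\max(a,0)$ and $a/0=\infty$ for $a>0$ (so $\theta_\infty$ can be $+\infty$). A matrix $\widetilde\Gamma$ for which the first term of the maximum is an undefined expression (such as $0/0$ or $0\cdot\infty$) is read as giving the value $+\infty$. *)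

theory Defs
  imports "HOL-Probability.Probability"
begin

(* A real N x T matrix is an element of real^'t^'n with N = CARD('n), T = CARD('t).
   The library's inner product and norm on this type are the trace inner product and the
   Frobenius norm. *)

lemma inner_matrix_eq_trace:
  fixes A B :: "real^'t^'n"
  shows "A \<bullet> B = trace (transpose A ** B)"
proof -
  have "A \<bullet> B = (\<Sum>i\<in>UNIV. \<Sum>j\<in>UNIV. A $ i $ j * B $ i $ j)"
    by (simp add: inner_vec_def)
  also have "\<dots> = (\<Sum>j\<in>UNIV. \<Sum>i\<in>UNIV. A $ i $ j * B $ i $ j)"
    by (rule sum.swap)
  also have "\<dots> = trace (transpose A ** B)"
    by (simp add: trace_def matrix_matrix_mult_def transpose_def)
  finally show ?thesis .
qed

lemma norm_matrix_eq_frobenius: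
  fixes A :: "real^'t^'n"
  shows "norm A = sqrt (\<Sum>i\<in>UNIV. \<Sum>j\<in>UNIV. (A $ i $ j)\<^sup>2)"
  by (simp add: norm_eq_sqrt_inner inner_vec_def power2_eq_square)

definition op_norm :: "real^'t^'n \<Rightarrow> real" where
  "op_norm A = onorm (\<lambda>x. A *v x)"

text \<open>The nuclear norm is the sum of the singular values; a singular value is repeated
  according to the dimension of the corresponding eigenspace of \<open>A\<^sup>T A\<close>.\<close>

definition singular_space :: "real^'t^'n \<Rightarrow> real \<Rightarrow> (real^'t) set" where
  "singular_space A s = {v. (transpose A ** A) *v v = s\<^sup>2 *\<^sub>R v}"

definition singular_values :: "real^'t^'n \<Rightarrow> real set" where
  "singular_values A = {s. s \<ge> 0 \<and> (\<exists>v. v \<noteq> 0 \<and> v \<in> singular_space A s)}"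

definition nuclear_norm :: "real^'t^'n \<Rightarrow> real" where
  "nuclear_norm A = (\<Sum>s\<in>singular_values A. real (dim (singular_space A s)) * s)"

lemma finite_singular_values: "finite (singular_values (A :: real^'t^'n))"
proof -
  let ?B = "transpose A ** A"
  have B: "transpose ?B = ?B" by (simp add: matrix_transpose_mul)
  define v where "v s = (SOME v. v \<noteq> 0 \<and> v \<in> singular_space A s)" for s
  have v: "v s \<noteq> 0" "?B *v v s = s\<^sup>2 *\<^sub>R v s" if "s \<in> singular_values A" for s
  proof -
    have "\<exists>v. v \<noteq> 0 \<and> v \<in> singular_space A s"
      using that by (auto simp: singular_values_def)
    from someI_ex[OF this] show "v s \<noteq> 0" "?B *v v s = s\<^sup>2 *\<^sub>R v s"
      by (auto simp: v_def singular_space_def)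
  qed
  have orth: "v s \<bullet> v t = 0"
    if s: "s \<in> singular_values A" and t: "t \<in> singular_values A" and "s \<noteq> t" for s t
  proof -
    have "s\<^sup>2 * (v s \<bullet> v t) = (?B *v v s) \<bullet> v t"
      using v(2)[OF s] by simp
    also have "\<dots> = v s \<bullet> (?B *v v t)"
      by (metis B dot_lmul_matrix vector_transpose_matrix)
    also have "\<dots> = t\<^sup>2 * (v s \<bullet> v t)"
      using v(2)[OF t] by simp
    finally have "(s\<^sup>2 - t\<^sup>2) * (v s \<bullet> v t) = 0"
      by (simp add: algebra_simps)
    moreover have "s\<^sup>2 \<noteq> t\<^sup>2"
      using that by (auto simp: singular_values_def)
    ultimately show ?thesis by simp
  qed
  have "inj_on v (singular_values A)"
  proof (rule inj_onI, rule ccontr)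
    fix s t assume st: "s \<in> singular_values A" "t \<in> singular_values A" "v s = v t" "s \<noteq> t"
    then have "v s \<bullet> v s = 0" using orth by metis
    then show False using v(1)[OF st(1)] by simp
  qed
  moreover have "finite (v ` singular_values A)"
  proof (rule independent_imp_finite, rule pairwise_orthogonal_independent)
    show "pairwise orthogonal (v ` singular_values A)"
      using orth by (auto simp: pairwise_def orthogonal_def)
    show "0 \<notin> v ` singular_values A" using v(1) by force
  qed
  ultimately show ?thesis by (blast dest: finite_imageD)
qed

definition orth_proj :: "'a::euclidean_space set \<Rightarrow> 'a \<Rightarrow> 'a" where
  "orth_proj S x = (THE y. y \<in> S \<and> x - y \<in> orthogonal_comp S)"

lemma orth_proj_unique_existence:
  fixes S :: "'a::euclidean_space set"
  assumes "subspace S"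
  shows "\<exists>!y. y \<in> S \<and> x - y \<in> orthogonal_comp S"
proof -
  obtain y z where "y \<in> S" "z \<in> orthogonal_comp S" "x = y + z"
    using subspace_sum_orthogonal_comp[OF assms] set_plus_elim by (metis UNIV_I)
  moreover have "y = y'"
    if "y \<in> S" "x - y \<in> orthogonal_comp S" "y' \<in> S" "x - y' \<in> orthogonal_comp S" for y y'
  proof -
    have "y - y' \<in> S" using that assms by (simp add: subspace_diff)
    moreover have "(x - y') - (x - y) \<in> orthogonal_comp S"
      using that subspace_diff[OF subspace_orthogonal_comp] by blast
    ultimately have "orthogonal (y - y') (y - y')" by (simp add: orthogonal_comp_def)
    then show ?thesis by (simp add: orthogonal_def)
  qed
  ultimately show ?thesis by (metis add_diff_cancel_left')
qed

text \<open>\<open>M_X \<X>\<close> annihilates the span of the set \<open>\<X>\<close> of regressors.\<close>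

definition M_X :: "(real^'t^'n) set \<Rightarrow> real^'t^'n \<Rightarrow> real^'t^'n" where
  "M_X \<X> = orth_proj (orthogonal_comp (span \<X>))"

definition M_u :: "real^'t^'n \<Rightarrow> real^'n^'n" where
  "M_u A = matrix (orth_proj (orthogonal_comp (span (columns A))))"

definition M_v :: "real^'t^'n \<Rightarrow> real^'t^'t" where
  "M_v A = matrix (orth_proj (orthogonal_comp (span (rows A))))"

definition P_perp :: "real^'t^'n \<Rightarrow> real^'t^'n \<Rightarrow> real^'t^'n" where
  "P_perp A \<Delta> = M_u A ** \<Delta> ** M_v A"

definition P_par :: "real^'t^'n \<Rightarrow> real^'t^'n \<Rightarrow> real^'t^'n" where
  "P_par A \<Delta> = \<Delta> - P_perp A \<Delta>"

definition cone_set :: "real^'t^'n \<Rightarrow> real \<Rightarrow> (real^'t^'n) set" where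
  "cone_set A c = {\<Delta>. nuclear_norm (P_perp A \<Delta>) \<le> c * nuclear_norm (P_par A \<Delta>)}"

text \<open>The real division is never by zero: a nonzero \<open>\<Delta>\<close> in the cone has nonzero \<open>P_par A \<Delta>\<close>.\<close>

definition compat :: "(real^'t^'n) set \<Rightarrow> real^'t^'n \<Rightarrow> real \<Rightarrow> ereal" where
  "compat \<X> A c = (INF \<Delta>\<in>{\<Delta> \<in> cone_set A c. \<Delta> \<noteq> 0}.
     ereal (sqrt (2 * real (rank A)) * norm (M_X \<X> \<Delta>) / nuclear_norm (P_par A \<Delta>)))"

definition c_fun :: "real \<Rightarrow> real \<Rightarrow> real" where
  "c_fun \<rho> \<rho>' = (1 + \<rho> + \<rho>') / (1 - \<rho>)"

definition d_fun :: "real \<Rightarrow> real \<Rightarrow> real" where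
  "d_fun \<rho> \<rho>' = max (1 + \<rho>') (\<rho> * (1 + c_fun \<rho> \<rho>'))"

definition e_fun :: "real \<Rightarrow> real \<Rightarrow> real" where
  "e_fun \<rho> \<rho>' = d_fun \<rho> \<rho>' + \<rho> * (1 + c_fun \<rho> \<rho>')"

definition sqrt_NT :: "(real^'t^'n) itself \<Rightarrow> real" where
  "sqrt_NT _ = sqrt (real CARD('n) * real CARD('t))"

text \<open>In \<^typ>\<open>ereal\<close>, \<open>a / 0 = \<infinity>\<close> for \<open>a > 0\<close> and \<open>a / \<infinity> = 0\<close> for finite \<open>a\<close>. In \<open>theta_inf\<close>
  the inner quotient is never \<open>0 / 0\<close>: for \<open>G = 0\<close> the compatibility constant is \<open>\<infinity>\<close>.\<close>

definition theta_inf ::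
  "(real^'t^'n) set \<Rightarrow> real \<Rightarrow> real^'t^'n \<Rightarrow> real \<Rightarrow> real \<Rightarrow> ereal" where
  "theta_inf \<X> lam G \<rho> \<rho>' =
     2 * inverse (max 0 (1 -
       (ereal (d_fun \<rho> \<rho>' * sqrt (2 * real (rank G)) * lam) /
        (ereal (sqrt_NT TYPE(real^'t^'n)) * compat \<X> G (c_fun \<rho> \<rho>')))\<^sup>2))
     * ereal (e_fun \<rho> \<rho>')"

text \<open>Isabelle's \<^typ>\<open>ereal\<close> sets \<open>0 / 0\<close>, \<open>\<infinity> / \<infinity>\<close> and \<open>0 * \<infinity>\<close> to \<open>0\<close>; the next two operations
  instead read these undefined expressions as \<open>\<infinity>\<close>.\<close>

definition undef_inf_div :: "ereal \<Rightarrow> ereal \<Rightarrow> ereal" where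
  "undef_inf_div a b =
     (if (a = 0 \<and> b = 0) \<or> (\<bar>a\<bar> = \<infinity> \<and> \<bar>b\<bar> = \<infinity>) then \<infinity> else a / b)"

definition undef_inf_times :: "ereal \<Rightarrow> ereal \<Rightarrow> ereal" where
  "undef_inf_times a b =
     (if (a = 0 \<and> \<bar>b\<bar> = \<infinity>) \<or> (\<bar>a\<bar> = \<infinity> \<and> b = 0) then \<infinity> else a * b)"

definition theta ::
  "(real^'t^'n) set \<Rightarrow> real \<Rightarrow> real^'t^'n \<Rightarrow> real^'t^'n \<Rightarrow> real \<Rightarrow> real \<Rightarrow> ereal" where
  "theta \<X> lam \<Gamma> E \<rho> \<rho>' = (INF G.
     max (undef_inf_times (theta_inf \<X> lam G \<rho> \<rho>')
            (undef_inf_div (ereal (lam * real (rank G) * norm (M_X \<X> E)))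
               (ereal (sqrt_NT TYPE(real^'t^'n)) * (compat \<X> G (c_fun \<rho> \<rho>'))\<^sup>2)))
         (ereal (1 / \<rho>' * nuclear_norm (\<Gamma> - G))))"

definition theta_star ::
  "(real^'t^'n) set \<Rightarrow> real \<Rightarrow> real^'t^'n \<Rightarrow> real^'t^'n \<Rightarrow> real \<Rightarrow> ereal" where
  "theta_star \<X> lam \<Gamma> E \<rho> = (INF \<rho>'\<in>{0<..}. ereal (1 + c_fun \<rho> \<rho>') * theta \<X> lam \<Gamma> E \<rho> \<rho>')"

definition theta_sigma ::
  "(real^'t^'n) set \<Rightarrow> real \<Rightarrow> real^'t^'n \<Rightarrow> real^'t^'n \<Rightarrow> real \<Rightarrow> ereal" where
  "theta_sigma \<X> lam \<Gamma> E \<rho> = (INF \<rho>'\<in>{0<..}. ereal (d_fun \<rho> \<rho>') * theta \<X> lam \<Gamma> E \<rho> \<rho>')"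

text \<open>A coefficient vector in $\mathbb{R}^K$ is a function on \<^typ>\<open>nat\<close> of which only the values at
  \<open>1, \<dots>, K\<close> are used.\<close>

definition lin_comb :: "nat \<Rightarrow> (nat \<Rightarrow> real^'t^'n) \<Rightarrow> (nat \<Rightarrow> real) \<Rightarrow> real^'t^'n" where
  "lin_comb K X b = (\<Sum>k=1..K. b k *\<^sub>R X k)"

definition scaled_residual ::
  "nat \<Rightarrow> (nat \<Rightarrow> real^'t^'n) \<Rightarrow> real^'t^'n \<Rightarrow> (nat \<Rightarrow> real) \<Rightarrow> real^'t^'n \<Rightarrow> real" where
  "scaled_residual K X Y b G =
     1 / sqrt_NT TYPE(real^'t^'n) * norm (Y - lin_comb K X b - G)"

definition objective ::
  "nat \<Rightarrow> (nat \<Rightarrow> real^'t^'n) \<Rightarrow> real^'t^'n \<Rightarrow> real \<Rightarrow> (nat \<Rightarrow> real) \<times> (real^'t^'n) \<Rightarrow> real" where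
  "objective K X Y lam = (\<lambda>(b, G).
     scaled_residual K X Y b G + lam / (real CARD('n) * real CARD('t)) * nuclear_norm G)"

end

theory Submission
  imports Defs
begin

text \<open>
  Profiling out \<open>b\<close>, the estimator minimises \<open>|M_X (Y - G)| + \<lambda>/\<surd>(NT) |G|\<^sub>*\<close>. Put
  \<open>\<Delta> = \<Gamma>_hat - \<Gamma>\<close>. By convexity of the norm and duality of operator and nuclear norm, on the
  event the residual can drop below \<open>|M_X E|\<close> by at most \<open>\<rho>\<lambda>/\<surd>(NT) |\<Delta>|\<^sub>*\<close>. Comparing this with
  optimality and with \<open>|A + P_perp A \<Delta>|\<^sub>* = |A|\<^sub>* + |P_perp A \<Delta>|\<^sub>*\<close> shows, for every matrix \<open>A\<close>
  and \<open>q = max (|P_par A \<Delta>|\<^sub>*) (2|\<Gamma> - A|\<^sub>*/\<rho>')\<close>, that \<open>|\<Delta>|\<^sub>* \<le> (1 + c) q\<close> and that the residual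
  differs from \<open>|M_X E|\<close> by at most \<open>\<lambda>/\<surd>(NT) d q\<close>. If \<open>q\<close> is the second term there is nothing left
  to do. Otherwise \<open>\<Delta>\<close> lies in the cone of \<open>A\<close>, and expanding \<open>|M_X (E - \<Delta>)|\<^sup>2\<close> gives a quadratic
  inequality for \<open>q\<close> whose solution, by compatibility, is the first term in \<open>\<theta>\<close>.
\<close>

section \<open>Eigenbases of self-adjoint maps\<close>

text \<open>Maximise the Rayleigh quotient over the unit sphere of \<open>S\<close>. At a maximiser
  \<open>v\<close> the residual \<open>u = f v - \<mu> v\<close> lies in \<open>S\<close> and is
  orthogonal to \<open>v\<close>, so moving along \<open>u\<close> would raise the quotient to first
  order unless \<open>u = 0\<close>.\<close>

lemma self_adjoint_eigenvector:
  fixes f :: "'a::euclidean_space \<Rightarrow> 'a"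
  assumes f: "linear f" and adj: "\<And>x y. f x \<bullet> y = x \<bullet> f y"
    and S: "subspace S" and inv: "f ` S \<subseteq> S" and nz: "S \<noteq> {0}"
  obtains v \<mu> where "v \<in> S" "norm v = 1" "f v = \<mu> *\<^sub>R v"
proof -
  let ?K = "S \<inter> sphere 0 1"
  have "compact ?K"
    using closed_subspace[OF S] by (simp add: closed_Int_compact)
  moreover have "?K \<noteq> {}"
  proof -
    obtain x where "x \<in> S" "x \<noteq> 0" using nz subspace_0[OF S] by auto
    then have "inverse (norm x) *\<^sub>R x \<in> ?K" by (simp add: subspace_scale[OF S])
    then show ?thesis by blast
  qed
  moreover have "continuous_on ?K (\<lambda>x. x \<bullet> f x)"
    by (intro continuous_intros linear_continuous_on f[unfolded linear_conv_bounded_linear])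
  ultimately have "\<exists>v\<in>?K. \<forall>y\<in>?K. y \<bullet> f y \<le> v \<bullet> f v"
    by (rule continuous_attains_sup)
  then obtain v where v: "v \<in> ?K" and vmax: "\<forall>y\<in>?K. y \<bullet> f y \<le> v \<bullet> f v" ..
  define \<mu> where "\<mu> = v \<bullet> f v"
  have vv: "v \<bullet> v = 1" using v by (simp add: dot_square_norm)
  have bound: "x \<bullet> f x \<le> \<mu> * (x \<bullet> x)" if "x \<in> S" for x
  proof (cases "x = 0")
    case False
    let ?y = "inverse (norm x) *\<^sub>R x"
    have "?y \<in> ?K" using False that by (simp add: subspace_scale[OF S])
    from vmax[rule_format, OF this] have "inverse (norm x) * (inverse (norm x) * (x \<bullet> f x)) \<le> \<mu>"
      by (simp add: \<mu>_def linear_scale[OF f])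
    then have "(x \<bullet> f x) / (norm x)\<^sup>2 \<le> \<mu>"
      by (simp add: field_simps power2_eq_square)
    then show ?thesis
      using False by (simp add: dot_square_norm field_simps)
  qed (simp add: linear_0[OF f])
  define u where "u = f v - \<mu> *\<^sub>R v"
  have uS: "u \<in> S" unfolding u_def using v inv S
    by (intro subspace_diff subspace_scale) auto
  have uv: "v \<bullet> u = 0" by (simp add: u_def inner_diff_right \<mu>_def vv)
  have fvu: "f v \<bullet> u = u \<bullet> u"
    using uv by (simp add: u_def inner_diff_left inner_commute algebra_simps)
  define C where "C = u \<bullet> f u - \<mu> * (u \<bullet> u)"
  have q: "2 * t * (u \<bullet> u) + t\<^sup>2 * C \<le> 0" for t
  proof -
    have "v + t *\<^sub>R u \<in> S" using v uS S by (auto intro: subspace_add subspace_scale)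
    note b = bound[OF this]
    have "(v + t *\<^sub>R u) \<bullet> f (v + t *\<^sub>R u) = \<mu> + 2 * t * (u \<bullet> u) + t\<^sup>2 * (u \<bullet> f u)"
      using fvu adj[of v u]
      by (simp add: linear_add[OF f] linear_scale[OF f] inner_add \<mu>_def inner_commute
          power2_eq_square algebra_simps)
    moreover have "(v + t *\<^sub>R u) \<bullet> (v + t *\<^sub>R u) = 1 + t\<^sup>2 * (u \<bullet> u)"
      using uv vv by (simp add: inner_add inner_commute power2_eq_square)
    ultimately show ?thesis using b by (simp add: C_def algebra_simps)
  qed
  have "u = 0"
  proof (rule ccontr)
    assume "u \<noteq> 0"
    then have a: "u \<bullet> u > 0" by simp
    \<comment> \<open>Small enough that \<open>t * \<bar>C\<bar> \<le> u \<bullet> u\<close>, so the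
      quadratic term cannot outweigh the linear one.\<close>
    define t where "t = (u \<bullet> u) / (\<bar>C\<bar> + 1)"
    have t: "t > 0" using a by (simp add: t_def)
    have "t * (2 * (u \<bullet> u) + t * C) \<le> 0"
      using q[of t] by (simp add: power2_eq_square algebra_simps)
    then have "2 * (u \<bullet> u) + t * C \<le> 0" using t by (simp add: mult_le_0_iff)
    moreover have "t * \<bar>C\<bar> \<le> u \<bullet> u"
      using a by (simp add: t_def field_simps)
    moreover have "- (t * \<bar>C\<bar>) \<le> t * C"
      using t abs_le_D2[of C "\<bar>C\<bar>"] by (metis abs_ge_minus_self abs_mult abs_of_pos minus_le_iff)
    ultimately show False using a by linarith
  qed
  then show ?thesis using that[of v \<mu>] v by (simp add: u_def)
qed

text \<open>Induction on the dimension: split off a unit eigenvector \<open>v\<close>; its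
  orthogonal complement in \<open>S\<close> is again invariant because \<open>f\<close> is
  self-adjoint.\<close>

lemma self_adjoint_eigenbasis:
  fixes f :: "'a::euclidean_space \<Rightarrow> 'a"
  assumes f: "linear f" and adj: "\<And>x y. f x \<bullet> y = x \<bullet> f y"
    and "subspace S" and "f ` S \<subseteq> S"
  shows "\<exists>B. B \<subseteq> S \<and> pairwise orthogonal B \<and> (\<forall>b\<in>B. norm b = 1 \<and> (\<exists>\<mu>. f b = \<mu> *\<^sub>R b)) \<and> span B = S"
  using assms(3,4)
proof (induction "dim S" arbitrary: S rule: less_induct)
  case less
  show ?case
  proof (cases "S = {0}")
    case True
    then show ?thesis by (intro exI[of _ "{}"]) auto
  next
    case False
    obtain v \<mu> where v: "v \<in> S" "norm v = 1" "f v = \<mu> *\<^sub>R v"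
      using self_adjoint_eigenvector[OF f adj less.prems False] by blast
    have vv: "v \<bullet> v = 1" using v by (simp add: dot_square_norm)
    define S' where "S' = S \<inter> {x. v \<bullet> x = 0}"
    have S': "subspace S'" unfolding S'_def
      using less.prems(1) subspace_hyperplane by (rule subspace_inter)
    have "v \<notin> S'" by (simp add: S'_def vv)
    then have "S' \<subset> S" using v(1) unfolding S'_def by blast
    then have "dim S' < dim S"
      by (metis S' less.prems(1) dim_psubset span_eq_iff)
    moreover have "f ` S' \<subseteq> S'"
      using less.prems(2) by (auto simp: S'_def adj[symmetric] v(3))
    ultimately obtain B where B: "B \<subseteq> S'" "pairwise orthogonal B"
      "\<forall>b\<in>B. norm b = 1 \<and> (\<exists>\<mu>. f b = \<mu> *\<^sub>R b)" "span B = S'"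
      using less.hyps[OF _ S'] by blast
    have "span (insert v B) = S"
    proof
      show "span (insert v B) \<subseteq> S"
        using v B(1) less.prems(1) by (intro span_minimal) (auto simp: S'_def)
      show "S \<subseteq> span (insert v B)"
      proof
        fix x assume x: "x \<in> S"
        have "x - (v \<bullet> x) *\<^sub>R v \<in> S'"
          using x v less.prems(1) vv
          by (simp add: S'_def inner_diff_right subspace_diff subspace_scale)
        then show "x \<in> span (insert v B)"
          unfolding span_breakdown_eq using B(4) by blast
      qed
    qed
    moreover have "pairwise orthogonal (insert v B)"
      using B(1,2) by (auto simp: pairwise_insert S'_def orthogonal_def inner_commute)
    ultimately show ?thesis
      using B v by (intro exI[of _ "insert v B"]) (auto simp: S'_def)
  qed
qed

section \<open>Expansions in an orthonormal basis\<close>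

locale orthonormal_basis =
  fixes B :: "'a::euclidean_space set"
  assumes orth: "pairwise orthogonal B"
    and unit: "\<And>b. b \<in> B \<Longrightarrow> norm b = 1"
    and span: "span B = UNIV"
begin

lemma indep: "independent B"
  using pairwise_orthogonal_independent[OF orth] unit by force

lemma finite [simp]: "finite B"
  using indep by (rule independent_imp_finite)

lemma inner_basis: "a \<in> B \<Longrightarrow> b \<in> B \<Longrightarrow> a \<bullet> b = (if a = b then 1 else 0)"
  using orth unit by (auto simp: pairwise_def orthogonal_def dot_square_norm)

lemma expand: "(\<Sum>b\<in>B. (x \<bullet> b) *\<^sub>R b) = x"
  using orthonormal_basis_expand[OF orth unit _ finite, of x] span by simp

lemma parseval: "x \<bullet> y = (\<Sum>b\<in>B. (x \<bullet> b) * (y \<bullet> b))"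
proof -
  have "x \<bullet> y = (\<Sum>b\<in>B. (x \<bullet> b) *\<^sub>R b) \<bullet> y" by (simp only: expand)
  also have "\<dots> = (\<Sum>b\<in>B. (x \<bullet> b) * (b \<bullet> y))"
    by (simp only: inner_sum_left inner_scaleR_left)
  finally show ?thesis by (simp add: inner_commute)
qed

end

section \<open>Nuclear norm and duality\<close>

declare transpose_matrix_vector [simp del]

lemma inner_matrix_vector_mult:
  fixes A :: "real^'t^'n"
  shows "(A *v x) \<bullet> y = x \<bullet> (transpose A *v y)"
  by (metis dot_lmul_matrix vector_transpose_matrix)

lemma minus_matrix_vector_mult: "(- A) *v x = - (A *v x)" for A :: "real^'t^'n"
  by (simp add: vec_eq_iff matrix_vector_mul_component)

text \<open>Parseval applied to each row: the trace inner product can be evaluated in any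
  orthonormal basis of the domain.\<close>

lemma inner_matrix_orthonormal_basis:
  fixes A C :: "real^'t^'n"
  assumes "orthonormal_basis B"
  shows "A \<bullet> C = (\<Sum>b\<in>B. (A *v b) \<bullet> (C *v b))"
proof -
  interpret orthonormal_basis B by fact
  have "A \<bullet> C = (\<Sum>i\<in>UNIV. \<Sum>b\<in>B. (A $ i \<bullet> b) * (C $ i \<bullet> b))"
    unfolding inner_vec_def[of A C] by (intro sum.cong refl parseval)
  also have "\<dots> = (\<Sum>b\<in>B. \<Sum>i\<in>UNIV. (A $ i \<bullet> b) * (C $ i \<bullet> b))"
    by (rule sum.swap)
  finally show ?thesis by (simp add: inner_vec_def[of "_ *v _"] matrix_vector_mul_component)
qed

text \<open>\<open>B\<close> is a basis of right singular vectors of \<open>A\<close>. Writing the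
  eigenvalue of \<open>transpose A ** A\<close> as a squared image norm makes
  \<open>norm (A *v b)\<close> the singular value at \<open>b\<close>.\<close>

locale right_singular_basis = orthonormal_basis B for B :: "(real^'t) set" +
  fixes A :: "real^'t^'n"
  assumes gram_basis: "b \<in> B \<Longrightarrow> transpose A *v (A *v b) = (norm (A *v b))\<^sup>2 *\<^sub>R b"
begin

lemma inner_images:
  "b \<in> B \<Longrightarrow> b' \<in> B \<Longrightarrow> (A *v b) \<bullet> (A *v b') = (if b = b' then (norm (A *v b))\<^sup>2 else 0)"
  by (simp add: inner_matrix_vector_mult gram_basis inner_basis)

text \<open>Expand an eigenvector in \<open>B\<close>: by self-adjointness its coefficient vanishes
  at every basis vector with another eigenvalue. Since \<open>s \<ge> 0\<close>, different singular
  values have different squares.\<close>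

lemma singular_space_eq_span:
  assumes "s \<ge> 0"
  shows "singular_space A s = span {b \<in> B. norm (A *v b) = s}"
proof
  show "span {b \<in> B. norm (A *v b) = s} \<subseteq> singular_space A s"
  proof (rule span_minimal)
    show "{b \<in> B. norm (A *v b) = s} \<subseteq> singular_space A s"
      using gram_basis by (auto simp: singular_space_def simp flip: matrix_vector_mul_assoc)
    show "subspace (singular_space A s)"
      by (auto simp: subspace_def singular_space_def matrix_vector_right_distrib
          matrix_vector_mult_scaleR scaleR_right_distrib)
  qed
  show "singular_space A s \<subseteq> span {b \<in> B. norm (A *v b) = s}"
  proof
    fix v assume v: "v \<in> singular_space A s"
    have "(v \<bullet> b) *\<^sub>R b \<in> span {b \<in> B. norm (A *v b) = s}" if b: "b \<in> B" for b
    proof (cases "norm (A *v b) = s")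
      case True
      then show ?thesis using b by (intro span_scale span_base) auto
    next
      case False
      then have ne: "(norm (A *v b))\<^sup>2 \<noteq> s\<^sup>2" using assms by simp
      have "s\<^sup>2 * (v \<bullet> b) = (transpose A *v (A *v v)) \<bullet> b"
        using v by (simp add: singular_space_def matrix_vector_mul_assoc)
      also have "\<dots> = v \<bullet> (transpose A *v (A *v b))"
        by (simp add: inner_matrix_vector_mult)
      also have "\<dots> = (norm (A *v b))\<^sup>2 * (v \<bullet> b)" using gram_basis[OF b] by simp
      finally have "v \<bullet> b = 0" using ne by auto
      then show ?thesis by (simp add: span_zero)
    qed
    then have "(\<Sum>b\<in>B. (v \<bullet> b) *\<^sub>R b) \<in> span {b \<in> B. norm (A *v b) = s}"
      by (rule span_sum)
    then show "v \<in> span {b \<in> B. norm (A *v b) = s}" by (simp only: expand)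
  qed
qed

text \<open>The multiplicity of \<open>s\<close> is the number of basis vectors with
  \<open>norm (A *v b) = s\<close>, so grouping the sum over \<open>B\<close> by this norm recovers
  the spectral definition.\<close>

lemma nuclear_norm_eq_sum: "nuclear_norm A = (\<Sum>b\<in>B. norm (A *v b))"
proof -
  have dim: "dim (singular_space A s) = card {b \<in> B. norm (A *v b) = s}" if "s \<ge> 0" for s
    unfolding singular_space_eq_span[OF that]
    by (metis (no_types, lifting) dim_span_eq_card_independent independent_mono indep mem_Collect_eq subsetI)
  have "(\<lambda>b. norm (A *v b)) ` B \<subseteq> singular_values A"
  proof clarify
    fix b assume b: "b \<in> B"
    then have "b \<noteq> 0" using unit by force
    moreover have "b \<in> singular_space A (norm (A *v b))"
      using gram_basis[OF b] by (simp add: singular_space_def matrix_vector_mul_assoc)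
    ultimately show "norm (A *v b) \<in> singular_values A"
      by (auto simp: singular_values_def)
  qed
  note group = sum.group[OF finite finite_singular_values this, of "\<lambda>b. norm (A *v b)"]
  have "nuclear_norm A = (\<Sum>s\<in>singular_values A. \<Sum>b\<in>{b \<in> B. norm (A *v b) = s}. norm (A *v b))"
    unfolding nuclear_norm_def
    by (intro sum.cong refl) (simp add: dim singular_values_def)
  then show ?thesis using group by simp
qed

end

text \<open>Take an eigenbasis of \<open>transpose A ** A\<close>; at a unit eigenvector
  \<open>b\<close> the eigenvalue equals \<open>b \<bullet> (transpose A *v (A *v b))\<close>, the
  squared norm of \<open>A *v b\<close>.\<close>

lemma right_singular_basis_exists:
  fixes A :: "real^'t^'n"
  obtains B where "right_singular_basis B A"
proof -
  let ?f = "\<lambda>x. transpose A *v (A *v x)"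
  have "linear ?f"
    by (simp add: matrix_vector_mul_assoc matrix_vector_mul_linear)
  moreover have "?f x \<bullet> y = x \<bullet> ?f y" for x y
    by (simp add: inner_matrix_vector_mult)
  ultimately obtain B where B: "pairwise orthogonal B" "span B = UNIV"
    and unit: "\<And>b. b \<in> B \<Longrightarrow> norm b = 1" and ev: "\<And>b. b \<in> B \<Longrightarrow> \<exists>\<mu>. ?f b = \<mu> *\<^sub>R b"
    using self_adjoint_eigenbasis[of ?f UNIV] by auto
  have "?f b = (norm (A *v b))\<^sup>2 *\<^sub>R b" if b: "b \<in> B" for b
  proof -
    obtain \<mu> where \<mu>: "?f b = \<mu> *\<^sub>R b" using ev[OF b] by blast
    have "(norm (A *v b))\<^sup>2 = b \<bullet> ?f b"
      by (simp add: inner_matrix_vector_mult flip: dot_square_norm)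
    also have "\<dots> = \<mu>" using \<mu> unit[OF b] by (simp add: dot_square_norm)
    finally show ?thesis using \<mu> by simp
  qed
  then have "right_singular_basis B A"
    using B unit by unfold_locales auto
  then show ?thesis by (rule that)
qed

lemma norm_matrix_vector_le_op_norm:
  fixes A :: "real^'t^'n"
  shows "norm (A *v x) \<le> op_norm A * norm x"
  unfolding op_norm_def by (rule onorm) (simp add: matrix_vector_mul_bounded_linear)

text \<open>Cauchy-Schwarz, term by term in a right singular basis of \<open>A\<close>. The free
  bound \<open>k\<close> serves both the operator norm and contractions, where
  \<open>k = 1\<close>.\<close>

lemma inner_le_nuclear_norm:
  fixes W A :: "real^'t^'n"
  assumes "\<And>x. norm (W *v x) \<le> k * norm x"
  shows "W \<bullet> A \<le> k * nuclear_norm A"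
proof -
  obtain B where "right_singular_basis B A" by (rule right_singular_basis_exists)
  then interpret right_singular_basis B A .
  have "W \<bullet> A = (\<Sum>b\<in>B. (W *v b) \<bullet> (A *v b))"
    by (intro inner_matrix_orthonormal_basis) unfold_locales
  also have "\<dots> \<le> (\<Sum>b\<in>B. k * norm (A *v b))"
  proof (rule sum_mono)
    fix b assume b: "b \<in> B"
    have "(W *v b) \<bullet> (A *v b) \<le> norm (W *v b) * norm (A *v b)" by (rule norm_cauchy_schwarz)
    also have "\<dots> \<le> k * norm (A *v b)"
      using assms[of b] unit[OF b] by (intro mult_right_mono) auto
    finally show "(W *v b) \<bullet> (A *v b) \<le> k * norm (A *v b)" .
  qed
  finally show ?thesis by (simp add: nuclear_norm_eq_sum sum_distrib_left)
qed

lemma inner_le_op_norm_nuclear_norm: "W \<bullet> A \<le> op_norm W * nuclear_norm (A :: real^'t^'n)"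
  by (intro inner_le_nuclear_norm norm_matrix_vector_le_op_norm)

text \<open>\<open>W\<close> is the partial isometry of the polar decomposition of \<open>A\<close>:
  it sends a singular vector \<open>b\<close> to \<open>sgn (A *v b)\<close>, which is 0 on the
  kernel. The kernel and range properties are what makes witnesses of orthogonal matrices
  addable.\<close>

lemma nuclear_norm_dual_witness:
  fixes A :: "real^'t^'n"
  obtains W :: "real^'t^'n" where "W \<bullet> A = nuclear_norm A" "\<And>x. norm (W *v x) \<le> norm x"
    "\<And>x. A *v x = 0 \<Longrightarrow> W *v x = 0" "range ((*v) W) \<subseteq> range ((*v) A)"
proof -
  obtain B where "right_singular_basis B A" by (rule right_singular_basis_exists)
  then interpret right_singular_basis B A .
  define W where "W = matrix (\<lambda>x. \<Sum>b\<in>B. (x \<bullet> b) *\<^sub>R sgn (A *v b))"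
  have lin: "linear (\<lambda>x. \<Sum>b\<in>B. (x \<bullet> b) *\<^sub>R sgn (A *v b))"
    by (intro linear_compose_sum ballI linearI) (simp_all add: inner_add_left scaleR_add_left)
  have W: "W *v x = (\<Sum>b\<in>B. (x \<bullet> b) *\<^sub>R sgn (A *v b))" for x
    unfolding W_def using matrix_vector_mul(2)[OF lin] by metis
  show ?thesis
  proof (rule that)
    have "W *v b = sgn (A *v b)" if "b \<in> B" for b
    proof -
      have "W *v b = (\<Sum>b'\<in>B. if b' = b then sgn (A *v b') else 0)"
        unfolding W by (intro sum.cong refl) (use that in \<open>auto simp: inner_basis\<close>)
      then show ?thesis using that by simp
    qed
    then have "W \<bullet> A = (\<Sum>b\<in>B. sgn (A *v b) \<bullet> (A *v b))"
      by (subst inner_matrix_orthonormal_basis[of B]) (unfold_locales, simp)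
    also have "\<dots> = nuclear_norm A"
      unfolding nuclear_norm_eq_sum
      by (intro sum.cong refl) (simp add: sgn_div_norm dot_square_norm power2_eq_square divide_simps)
    finally show "W \<bullet> A = nuclear_norm A" .
  next
    fix x
    \<comment> \<open>The vectors \<open>sgn (A *v b)\<close> are pairwise orthogonal with norm 0 or
      1, so Pythagoras and Parseval give the contraction bound.\<close>
    have "(norm (W *v x))\<^sup>2 = (\<Sum>b\<in>B. (norm ((x \<bullet> b) *\<^sub>R sgn (A *v b)))\<^sup>2)"
      unfolding W
      by (intro norm_sum_Pythagorean)
        (auto simp: pairwise_def orthogonal_def sgn_div_norm inner_images)
    also have "\<dots> \<le> (\<Sum>b\<in>B. (x \<bullet> b) * (x \<bullet> b))"
      by (intro sum_mono) (auto simp: norm_sgn power_mult_distrib power2_eq_square)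
    also have "\<dots> = (norm x)\<^sup>2" by (simp add: parseval[symmetric] dot_square_norm)
    finally show "norm (W *v x) \<le> norm x" by (simp add: power2_le_iff_abs_le)
  next
    fix x assume x: "A *v x = 0"
    have "(x \<bullet> b) *\<^sub>R sgn (A *v b) = 0" if b: "b \<in> B" for b
    proof -
      have "(norm (A *v b))\<^sup>2 * (x \<bullet> b) = x \<bullet> (transpose A *v (A *v b))"
        by (simp add: gram_basis[OF b])
      also have "\<dots> = 0" by (simp add: x flip: inner_matrix_vector_mult)
      finally show ?thesis by auto
    qed
    then show "W *v x = 0" unfolding W by (intro sum.neutral ballI)
  next
    \<comment> \<open>Division by zero gives 0, which agrees with \<open>sgn 0 = 0\<close>, so basis
      vectors in the kernel of \<open>A\<close> need no separate case.\<close>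
    have "W *v x = A *v (\<Sum>b\<in>B. ((x \<bullet> b) / norm (A *v b)) *\<^sub>R b)" for x
      by (simp add: W linear_sum[OF matrix_vector_mul_linear] matrix_vector_mult_scaleR
          sgn_div_norm divide_inverse_commute mult.commute)
    then show "range ((*v) W) \<subseteq> range ((*v) A)" by blast
  qed
qed

lemma nuclear_norm_nonneg: "0 \<le> nuclear_norm (A :: real^'t^'n)"
  unfolding nuclear_norm_def by (intro sum_nonneg) (auto simp: singular_values_def)

lemma nuclear_norm_zero [simp]: "nuclear_norm (0 :: real^'t^'n) = 0"
  by (metis inner_zero_right nuclear_norm_dual_witness)

lemma nuclear_norm_eq_0_iff [simp]: "nuclear_norm A = 0 \<longleftrightarrow> A = (0 :: real^'t^'n)"
proof
  assume "nuclear_norm A = 0"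
  then have "A \<bullet> A \<le> 0" using inner_le_op_norm_nuclear_norm[of A A] by simp
  then show "A = 0" by (metis inner_gt_zero_iff not_le)
qed simp

text \<open>A dual witness of the sum is a contraction, so duality bounds its inner product with
  each summand.\<close>

lemma nuclear_norm_triangle: "nuclear_norm (A + C) \<le> nuclear_norm A + nuclear_norm (C :: real^'t^'n)"
proof -
  obtain W where W: "W \<bullet> (A + C) = nuclear_norm (A + C)" "\<And>x. norm (W *v x) \<le> norm x"
    by (rule nuclear_norm_dual_witness[of "A + C"]) blast
  then show ?thesis
    using inner_le_nuclear_norm[of W 1 A] inner_le_nuclear_norm[of W 1 C]
    by (simp add: inner_add_right)
qed

lemma nuclear_norm_minus [simp]: "nuclear_norm (- A) = nuclear_norm (A :: real^'t^'n)"
proof -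
  have "nuclear_norm C \<le> nuclear_norm (- C)" for C :: "real^'t^'n"
  proof -
    obtain W where W: "W \<bullet> C = nuclear_norm C" "\<And>x. norm (W *v x) \<le> norm x"
      by (rule nuclear_norm_dual_witness[of C]) blast
    have "norm ((- W) *v x) \<le> 1 * norm x" for x
      using W(2)[of x] by (simp add: minus_matrix_vector_mult)
    from inner_le_nuclear_norm[OF this, of "- C"] show ?thesis using W(1) by simp
  qed
  from this[of A] this[of "- A"] show ?thesis by simp
qed

text \<open>Dual witnesses of \<open>A\<close> and \<open>D\<close> have orthogonal row and column spaces, so their sum is
  still a contraction.\<close>

lemma nuclear_norm_add_orthogonal:
  fixes A D :: "real^'t^'n"
  assumes col: "transpose A ** D = 0" and row: "D ** transpose A = 0"
  shows "nuclear_norm A + nuclear_norm D \<le> nuclear_norm (A + D)"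
proof -
  obtain W where W: "W \<bullet> A = nuclear_norm A" "\<And>x. norm (W *v x) \<le> norm x"
    "\<And>x. A *v x = 0 \<Longrightarrow> W *v x = 0" "range ((*v) W) \<subseteq> range ((*v) A)"
    by (rule nuclear_norm_dual_witness[of A]) (rule that; blast)
  obtain V where V: "V \<bullet> D = nuclear_norm D" "\<And>x. norm (V *v x) \<le> norm x"
    "\<And>x. D *v x = 0 \<Longrightarrow> V *v x = 0" "range ((*v) V) \<subseteq> range ((*v) D)"
    by (rule nuclear_norm_dual_witness[of D]) (rule that; blast)
  have AD: "(A *v x) \<bullet> (D *v y) = 0" for x y
    by (simp add: inner_matrix_vector_mult matrix_vector_mul_assoc col)
  have "\<exists>z. W *v x = A *v z" "\<exists>z. V *v x = D *v z" for x
    using W(4) V(4) by blast+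
  then have WD: "(W *v x) \<bullet> (D *v y) = 0" and AV: "(A *v x) \<bullet> (V *v y) = 0"
    and WV: "(W *v x) \<bullet> (V *v y) = 0" for x y
    using AD by metis+
  obtain B :: "(real^'t) set" where "right_singular_basis B A" by (rule right_singular_basis_exists)
  then interpret right_singular_basis B A .
  note inner_basis = inner_matrix_orthonormal_basis[OF orthonormal_basis_axioms]
  have "W \<bullet> D = 0" "V \<bullet> A = 0"
    using WD AV by (simp_all add: inner_basis inner_commute[of "V *v _"])
  then have "(W + V) \<bullet> (A + D) = nuclear_norm A + nuclear_norm D"
    by (simp add: inner_add_left inner_add_right W(1) V(1))
  moreover have "norm ((W + V) *v x) \<le> 1 * norm x" for x
  proof -
    \<comment> \<open>Split \<open>x\<close> along the row space of \<open>A\<close> and its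
      complement, the kernel of \<open>A\<close>. \<open>W\<close> kills the kernel part and, as
      \<open>D ** transpose A = 0\<close>, \<open>V\<close> kills the row-space part; the two images
      that remain are orthogonal.\<close>
    let ?S = "range (\<lambda>y. transpose A *v y)"
    have "subspace ?S"
      by (intro linear_subspace_image matrix_vector_mul_linear subspace_UNIV)
    then obtain x1 x2 where x: "x = x1 + x2" and x1: "x1 \<in> ?S" and x2: "x2 \<in> orthogonal_comp ?S"
      using subspace_sum_orthogonal_comp set_plus_elim by (metis UNIV_I)
    have "z \<bullet> (A *v x2) = 0" for z
      using x2 by (auto simp: orthogonal_comp_def orthogonal_def inner_matrix_vector_mult
          inner_commute[of z] inner_commute[of x2])
    then have "A *v x2 = 0" using inner_eq_zero_iff by blast
    then have "W *v x2 = 0" by (rule W(3))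
    moreover have "V *v x1 = 0"
      using x1 row by (intro V(3)) (auto simp: matrix_vector_mul_assoc)
    ultimately have eq: "(W + V) *v x = W *v x1 + V *v x2"
      by (simp add: x matrix_vector_mult_add_rdistrib matrix_vector_right_distrib)
    have "(norm ((W + V) *v x))\<^sup>2 = (norm (W *v x1))\<^sup>2 + (norm (V *v x2))\<^sup>2"
      unfolding eq using WV by (intro norm_add_Pythagorean) (simp add: orthogonal_def)
    also have "\<dots> \<le> (norm x1)\<^sup>2 + (norm x2)\<^sup>2"
      by (intro add_mono power_mono W(2) V(2)) auto
    also have "\<dots> = (norm x)\<^sup>2"
      unfolding x using x1 x2 by (intro norm_add_Pythagorean[symmetric]) (auto simp: orthogonal_comp_def)
    finally show ?thesis by (simp add: power2_le_iff_abs_le)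
  qed
  ultimately show ?thesis
    using inner_le_nuclear_norm[of "W + V" 1 "A + D"] by simp
qed

section \<open>Orthogonal projections\<close>

lemma orth_proj_in: "subspace S \<Longrightarrow> orth_proj S x \<in> S"
  and orth_proj_diff: "subspace S \<Longrightarrow> x - orth_proj S x \<in> orthogonal_comp S"
  unfolding orth_proj_def by (blast dest: theI'[OF orth_proj_unique_existence])+

lemma orth_proj_eqI:
  "subspace S \<Longrightarrow> y \<in> S \<Longrightarrow> x - y \<in> orthogonal_comp S \<Longrightarrow> orth_proj S x = y"
  unfolding orth_proj_def by (rule the1_equality[OF orth_proj_unique_existence]) auto

lemma linear_orth_proj:
  assumes S: "subspace S"
  shows "linear (orth_proj S)"
proof (rule linearI)
  note spec = orth_proj_in[OF S] orth_proj_diff[OF S]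
  show "orth_proj S (x + y) = orth_proj S x + orth_proj S y" for x y
    using subspace_add[OF S spec(1)[of x] spec(1)[of y]]
      subspace_add[OF subspace_orthogonal_comp spec(2)[of x] spec(2)[of y]]
    by (intro orth_proj_eqI S) (simp_all add: algebra_simps)
  show "orth_proj S (c *\<^sub>R x) = c *\<^sub>R orth_proj S x" for c x
    using subspace_scale[OF S spec(1)[of x]]
      subspace_scale[OF subspace_orthogonal_comp spec(2)[of x], of c]
    by (intro orth_proj_eqI S) (simp_all add: algebra_simps)
qed

lemma orth_proj_UNIV [simp]: "orth_proj UNIV = id"
  by (rule ext) (auto intro: orth_proj_eqI)

lemma orth_proj_orthogonal_comp_eq_0:
  assumes "x \<in> S" shows "orth_proj (orthogonal_comp S) x = 0"
  using assms orthogonal_comp_subset[of S]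
  by (intro orth_proj_eqI subspace_orthogonal_comp) (auto simp: subspace_0 subspace_orthogonal_comp)

lemma matrix_orth_proj: "subspace S \<Longrightarrow> matrix (orth_proj S) *v x = orth_proj S x"
  for S :: "(real^'a) set"
  by (simp add: matrix_vector_mul(2)[OF linear_orth_proj])

text \<open>\<open>M_u A\<close> maps into the complement of the column space of \<open>A\<close>,
  which is the kernel of \<open>transpose A\<close>. This and \<open>P_perp_mult_transpose\<close>
  supply the hypotheses of \<open>nuclear_norm_add_orthogonal\<close>.\<close>

lemma transpose_mult_P_perp: "transpose A ** P_perp A \<Delta> = 0"
  for A :: "real^'t^'n"
proof -
  have "transpose A *v (M_u A *v x) = 0" for x
  proof -
    have "z \<bullet> (transpose A *v (M_u A *v x)) = 0" for z
    proof -
      have "A *v z \<in> span (columns A)" by (rule matrix_vector_mult_in_columnspace)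
      moreover have "M_u A *v x \<in> orthogonal_comp (span (columns A))"
        by (simp add: M_u_def matrix_orth_proj orth_proj_in subspace_orthogonal_comp)
      ultimately show ?thesis
        by (simp add: orthogonal_comp_def orthogonal_def flip: inner_matrix_vector_mult)
    qed
    then show ?thesis using inner_eq_zero_iff by blast
  qed
  then have "transpose A ** M_u A = 0"
    by (simp add: matrix_eq flip: matrix_vector_mul_assoc)
  then show ?thesis by (simp add: P_perp_def matrix_mul_assoc)
qed

lemma P_perp_mult_transpose: "P_perp A \<Delta> ** transpose A = 0"
  for A :: "real^'t^'n"
proof -
  have "M_v A *v (transpose A *v x) = 0" for x
    using matrix_vector_mult_in_columnspace[of "transpose A" x]
    by (simp add: M_v_def matrix_orth_proj subspace_orthogonal_comp orth_proj_orthogonal_comp_eq_0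
        columns_transpose)
  then have "M_v A ** transpose A = 0"
    by (simp add: matrix_eq flip: matrix_vector_mul_assoc)
  then show ?thesis by (simp add: P_perp_def flip: matrix_mul_assoc)
qed

text \<open>Hence \<open>P_par 0\<close> vanishes, which rules out rank zero for a nonzero element
  of the cone.\<close>

lemma P_perp_0_left [simp]: "P_perp 0 \<Delta> = (\<Delta> :: real^'t^'n)"
proof -
  have "columns (0 :: real^'t^'n) = {0}" "rows (0 :: real^'t^'n) = {0}"
    by (auto simp: columns_def rows_def column_def row_def vec_eq_iff)
  then show ?thesis
    by (simp add: P_perp_def M_u_def M_v_def matrix_id_mat_1)
qed

lemma P_perp_0_right [simp]: "P_perp A 0 = (0 :: real^'t^'n)"
  by (simp add: P_perp_def)

lemma P_par_0_right [simp]: "P_par A 0 = (0 :: real^'t^'n)"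
  by (simp add: P_par_def)

section \<open>The projection that annihilates the regressors\<close>

lemma M_X_in: "M_X \<X> a \<in> orthogonal_comp (span \<X>)"
  unfolding M_X_def by (intro orth_proj_in subspace_orthogonal_comp)

lemma diff_M_X_in_span: "a - M_X \<X> a \<in> span \<X>"
  using orth_proj_diff[OF subspace_orthogonal_comp, of a "span \<X>"]
  by (simp add: M_X_def orthogonal_comp_self)

lemma linear_M_X: "linear (M_X \<X>)"
  unfolding M_X_def by (intro linear_orth_proj subspace_orthogonal_comp)

lemma M_X_eq_0: "x \<in> span \<X> \<Longrightarrow> M_X \<X> x = 0"
  unfolding M_X_def by (rule orth_proj_orthogonal_comp_eq_0)

lemma inner_M_X: "M_X \<X> a \<bullet> b = M_X \<X> a \<bullet> M_X \<X> b"
proof -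
  have "M_X \<X> a \<bullet> (b - M_X \<X> b) = 0"
    using M_X_in[of \<X> a] diff_M_X_in_span[of b \<X>]
    by (simp add: orthogonal_comp_def orthogonal_def inner_commute[of "M_X \<X> a"])
  then show ?thesis by (simp add: inner_diff_right)
qed

lemma norm_M_X_le: "norm (M_X \<X> a) \<le> norm a"
proof -
  have "norm (M_X \<X> a) * norm (M_X \<X> a) = M_X \<X> a \<bullet> a"
    by (simp add: inner_M_X[of \<X> a a] dot_square_norm power2_eq_square)
  also have "\<dots> \<le> norm (M_X \<X> a) * norm a" by (rule norm_cauchy_schwarz)
  finally show ?thesis by (cases "norm (M_X \<X> a) = 0") auto
qed

text \<open>The least-squares property: \<open>M_X\<close> is a contraction that does not see
  \<open>x\<close>.\<close>

lemma norm_M_X_le_diff: "x \<in> span \<X> \<Longrightarrow> norm (M_X \<X> a) \<le> norm (a - x)"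
  using norm_M_X_le[of \<X> "a - x"] by (simp add: linear_diff[OF linear_M_X] M_X_eq_0)

text \<open>Turns minimisation over coefficients into minimisation over a subspace.\<close>

lemma range_lin_comb: "range (lin_comb K X) = span (X ` {1..K})"
proof
  show "range (lin_comb K X) \<subseteq> span (X ` {1..K})"
    unfolding lin_comb_def by (intro image_subsetI span_sum span_scale span_base imageI)
  show "span (X ` {1..K}) \<subseteq> range (lin_comb K X)"
  proof (rule span_minimal)
    show "X ` {1..K} \<subseteq> range (lin_comb K X)"
    proof clarify
      fix k assume "k \<in> {1..K}"
      then have "lin_comb K X (\<lambda>i. if i = k then 1 else 0) = X k"
        by (simp add: lin_comb_def if_distrib[of "\<lambda>c. c *\<^sub>R _"] cong: if_cong)
      then show "X k \<in> range (lin_comb K X)" by (metis rangeI)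
    qed
    have "lin_comb K X b + lin_comb K X b' = lin_comb K X (\<lambda>k. b k + b' k)"
      "c *\<^sub>R lin_comb K X b = lin_comb K X (\<lambda>k. c * b k)"
      "0 = lin_comb K X (\<lambda>_. 0)" for b b' c
      by (simp_all add: lin_comb_def scaleR_add_left sum.distrib scaleR_sum_right)
    then show "subspace (range (lin_comb K X))"
      by (auto simp: subspace_def)
  qed
qed

section \<open>Profiling the coefficients out of the objective\<close>

lemma sqrt_NT_pos: "0 < sqrt_NT TYPE(real^'t^'n)"
  by (simp add: sqrt_NT_def)

lemma sqrt_NT_power2: "(sqrt_NT TYPE(real^'t^'n))\<^sup>2 = real CARD('n) * real CARD('t)"
  by (simp add: sqrt_NT_def)

text \<open>For each fixed matrix the best residual over all coefficients is its image under
  \<open>M_X\<close>. Comparing the minimiser with the profiled objective at \<open>G\<close> itself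
  gives the first claim, since the penalties cancel, and at \<open>G'\<close> the second.\<close>

lemma arg_min_objective_profile:
  fixes X :: "nat \<Rightarrow> real^'t^'n"
  assumes min: "is_arg_min (objective K X Y lam) (\<lambda>_. True) (b, G)"
  shows "norm (Y - lin_comb K X b - G) = norm (M_X (X ` {1..K}) (Y - G))" (is ?res)
    and "norm (M_X (X ` {1..K}) (Y - G)) / sqrt_NT TYPE(real^'t^'n)
           + lam / (real CARD('n) * real CARD('t)) * nuclear_norm G
         \<le> norm (M_X (X ` {1..K}) (Y - G')) / sqrt_NT TYPE(real^'t^'n)
           + lam / (real CARD('n) * real CARD('t)) * nuclear_norm G'" (is ?opt)
proof -
  let ?m = "sqrt_NT TYPE(real^'t^'n)" and ?M = "M_X (X ` {1..K})"
    and ?l = "lam / (real CARD('n) * real CARD('t))"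
  have le: "norm (Y - lin_comb K X b - G) / ?m + ?l * nuclear_norm G
      \<le> norm (?M (Y - H)) / ?m + ?l * nuclear_norm H" for H
  proof -
    \<comment> \<open>The least-squares coefficients for \<open>H\<close>.\<close>
    obtain b' where b': "(Y - H) - ?M (Y - H) = lin_comb K X b'"
      using diff_M_X_in_span[of "Y - H" "X ` {1..K}"] unfolding range_lin_comb[symmetric] by blast
    have "objective K X Y lam (b, G) \<le> objective K X Y lam (b', H)"
      using min by (simp add: is_arg_min_linorder)
    moreover have "Y - lin_comb K X b' - H = ?M (Y - H)"
      by (simp flip: b')
    ultimately show ?thesis by (simp add: objective_def scaled_residual_def)
  qed
  have "norm (?M (Y - G)) \<le> norm (Y - G - lin_comb K X b)"
    by (rule norm_M_X_le_diff) (metis range_lin_comb rangeI)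
  moreover have "norm (Y - lin_comb K X b - G) \<le> norm (?M (Y - G))"
    using le[of G] sqrt_NT_pos[where 't='t and 'n='n] by (simp add: divide_le_cancel)
  ultimately show res: ?res by (simp add: algebra_simps)
  show ?opt using le[of G'] by (simp add: res)
qed

section \<open>Error bounds on the event\<close>

text \<open>The situation at one fixed outcome. The competitor in \<open>optimal\<close> is
  \<open>\<Gamma>\<close>, whose profiled residual is \<open>M_X \<X> E\<close>.\<close>

locale sqrt_lasso_event =
  fixes \<X> :: "(real^'t^'n) set" and \<Gamma> E G :: "real^'t^'n" and lam \<rho> :: real
  assumes lam: "lam > 0" and \<rho>: "0 < \<rho>" "\<rho> < 1"
    and optimal:
      "norm (M_X \<X> (\<Gamma> + E - G)) / sqrt_NT TYPE(real^'t^'n)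
         + lam / (real CARD('n) * real CARD('t)) * nuclear_norm G
       \<le> norm (M_X \<X> E) / sqrt_NT TYPE(real^'t^'n)
         + lam / (real CARD('n) * real CARD('t)) * nuclear_norm \<Gamma>"
    and event: "op_norm (M_X \<X> E) \<le> \<rho> * lam * (norm (M_X \<X> E) / sqrt_NT TYPE(real^'t^'n))"
begin

definition m :: real where "m = sqrt_NT TYPE(real^'t^'n)"
definition e :: real where "e = norm (M_X \<X> E)"
definition \<Delta> :: "real^'t^'n" where "\<Delta> = G - \<Gamma>"
definition r :: real where "r = norm (M_X \<X> (\<Gamma> + E - G))"

lemma m_pos: "m > 0"
  unfolding m_def by (rule sqrt_NT_pos)

lemma e_nonneg: "e \<ge> 0"
  by (simp add: e_def)

lemma M_residual: "M_X \<X> (\<Gamma> + E - G) = M_X \<X> E - M_X \<X> \<Delta>"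
  by (simp add: \<Delta>_def linear_diff[OF linear_M_X] linear_add[OF linear_M_X])

text \<open>Duality, with the event replacing the operator norm. The factor \<open>e\<close> is kept
  apart so that it can be cancelled in \<open>residual_ge\<close>.\<close>

lemma inner_E_le: "\<bar>M_X \<X> E \<bullet> \<Delta>\<bar> \<le> e * (\<rho> * lam / m * nuclear_norm \<Delta>)"
proof -
  have "\<bar>M_X \<X> E \<bullet> \<Delta>\<bar> \<le> op_norm (M_X \<X> E) * nuclear_norm \<Delta>"
    using inner_le_op_norm_nuclear_norm[of "M_X \<X> E" \<Delta>]
      inner_le_op_norm_nuclear_norm[of "M_X \<X> E" "- \<Delta>"] by simp
  also have "\<dots> \<le> (\<rho> * lam * (e / m)) * nuclear_norm \<Delta>"
    unfolding e_def m_def by (intro mult_right_mono event nuclear_norm_nonneg)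
  finally show ?thesis by (simp add: field_simps)
qed

text \<open>The subgradient inequality of the norm at \<open>M_X \<X> E\<close>: by Cauchy-Schwarz
  \<open>e * r\<close> is at least the inner product of \<open>M_X \<X> E\<close> with the residual,
  and one divides by \<open>e\<close>.\<close>

lemma residual_ge: "e - \<rho> * lam / m * nuclear_norm \<Delta> \<le> r"
proof (cases "e = 0")
  \<comment> \<open>The norm has no gradient at 0, but here the lower bound is not positive.\<close>
  case True
  have "0 \<le> \<rho> * lam / m * nuclear_norm \<Delta>"
    using \<rho> lam m_pos by (simp add: nuclear_norm_nonneg)
  moreover have "0 \<le> r" by (simp add: r_def)
  ultimately show ?thesis using True by simp
next
  case False
  have "e * (e - \<rho> * lam / m * nuclear_norm \<Delta>) \<le> e * e - M_X \<X> E \<bullet> \<Delta>"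
    using inner_E_le by (simp add: right_diff_distrib)
  also have "\<dots> = M_X \<X> E \<bullet> M_X \<X> (\<Gamma> + E - G)"
    by (simp add: M_residual inner_diff_right e_def dot_square_norm power2_eq_square inner_M_X[of \<X> E \<Delta>])
  also have "\<dots> \<le> e * r"
    unfolding e_def r_def by (rule norm_cauchy_schwarz)
  finally show ?thesis using False e_nonneg by (simp add: mult_le_cancel_left)
qed

lemma residual_le: "r \<le> e + lam / m * (nuclear_norm \<Gamma> - nuclear_norm G)"
proof -
  have "r / m + lam / m\<^sup>2 * nuclear_norm G \<le> e / m + lam / m\<^sup>2 * nuclear_norm \<Gamma>"
    using optimal by (simp add: r_def e_def m_def sqrt_NT_power2)
  then have "m * (r / m + lam / m\<^sup>2 * nuclear_norm G) \<le> m * (e / m + lam / m\<^sup>2 * nuclear_norm \<Gamma>)"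
    using m_pos by simp
  then show ?thesis
    using m_pos by (simp add: power2_eq_square algebra_simps diff_divide_distrib)
qed

text \<open>Additivity across \<open>A\<close> and \<open>P_perp A \<Delta>\<close>, whose sum is
  \<open>G\<close> minus \<open>P_par A \<Delta> + (\<Gamma> - A)\<close>. The approximation error
  is paid twice: for passing to \<open>G\<close>, and for replacing \<open>\<Gamma>\<close> by
  \<open>A\<close>.\<close>

lemma nuclear_norm_gap_le:
  "nuclear_norm \<Gamma> - nuclear_norm G
     \<le> nuclear_norm (P_par A \<Delta>) - nuclear_norm (P_perp A \<Delta>) + 2 * nuclear_norm (\<Gamma> - A)"
proof -
  have "nuclear_norm A + nuclear_norm (P_perp A \<Delta>) \<le> nuclear_norm (A + P_perp A \<Delta>)"
    by (intro nuclear_norm_add_orthogonal transpose_mult_P_perp P_perp_mult_transpose)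
  also have "A + P_perp A \<Delta> = G + - (P_par A \<Delta> + (\<Gamma> - A))"
    by (simp add: P_par_def \<Delta>_def)
  also have "nuclear_norm \<dots> \<le> nuclear_norm G + nuclear_norm (P_par A \<Delta> + (\<Gamma> - A))"
    using nuclear_norm_triangle[of G "- (P_par A \<Delta> + (\<Gamma> - A))"] by (simp only: nuclear_norm_minus)
  also have "\<dots> \<le> nuclear_norm G + (nuclear_norm (P_par A \<Delta>) + nuclear_norm (\<Gamma> - A))"
    by (intro add_left_mono nuclear_norm_triangle)
  finally show ?thesis
    using nuclear_norm_triangle[of A "\<Gamma> - A"] by simp
qed

lemma nuclear_norm_error_le_parts:
  "nuclear_norm \<Delta> \<le> nuclear_norm (P_par A \<Delta>) + nuclear_norm (P_perp A \<Delta>)"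
  using nuclear_norm_triangle[of "P_par A \<Delta>" "P_perp A \<Delta>"] by (simp add: P_par_def)

text \<open>The two residual bounds together give \<open>nuclear_norm G - nuclear_norm \<Gamma>
  \<le> \<rho> * nuclear_norm \<Delta>\<close>; splitting \<open>\<Delta>\<close> and collecting its
  \<open>P_perp\<close> part leaves the factor \<open>1 - \<rho>\<close>.\<close>

lemma scaled_nuclear_norm_P_perp_le:
  "(1 - \<rho>) * nuclear_norm (P_perp A \<Delta>)
     \<le> (1 + \<rho>) * nuclear_norm (P_par A \<Delta>) + 2 * nuclear_norm (\<Gamma> - A)"
proof -
  have "lam / m * (nuclear_norm G - nuclear_norm \<Gamma>) \<le> lam / m * (\<rho> * nuclear_norm \<Delta>)"
    using residual_ge residual_le by (simp add: algebra_simps diff_divide_distrib)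
  then have "nuclear_norm G - nuclear_norm \<Gamma> \<le> \<rho> * nuclear_norm \<Delta>"
    using lam m_pos by (simp add: divide_le_cancel)
  also have "\<dots> \<le> \<rho> * (nuclear_norm (P_par A \<Delta>) + nuclear_norm (P_perp A \<Delta>))"
    using \<rho> nuclear_norm_error_le_parts[of A] by (intro mult_left_mono) auto
  finally show ?thesis
    using nuclear_norm_gap_le[of A] by (simp add: algebra_simps)
qed

text \<open>One number \<open>q\<close> dominates both the \<open>P_par\<close> part of the error
  and the approximation error. In units of \<open>q\<close>, \<open>c_fun\<close> bounds the
  \<open>P_perp\<close> part, \<open>d_fun\<close> the residual error, and \<open>e_fun\<close> is
  the linear coefficient of the squared prediction error.\<close>

context
  fixes A :: "real^'t^'n" and \<rho>' q :: real
  assumes \<rho>': "\<rho>' > 0"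
    and p_le: "nuclear_norm (P_par A \<Delta>) \<le> q"
    and gap_le: "2 * nuclear_norm (\<Gamma> - A) \<le> \<rho>' * q"
begin

lemma nuclear_norm_P_perp_le: "nuclear_norm (P_perp A \<Delta>) \<le> c_fun \<rho> \<rho>' * q"
proof -
  have "(1 + \<rho>) * nuclear_norm (P_par A \<Delta>) \<le> (1 + \<rho>) * q"
    using p_le \<rho> by (intro mult_left_mono) auto
  then have "(1 - \<rho>) * nuclear_norm (P_perp A \<Delta>) \<le> (1 + \<rho> + \<rho>') * q"
    using scaled_nuclear_norm_P_perp_le[of A] gap_le by (simp add: algebra_simps)
  then show ?thesis
    using \<rho> by (simp add: c_fun_def field_simps)
qed

lemma nuclear_norm_error_le: "nuclear_norm \<Delta> \<le> (1 + c_fun \<rho> \<rho>') * q"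
  using nuclear_norm_error_le_parts[of A] nuclear_norm_P_perp_le p_le by (simp add: algebra_simps)

text \<open>The maximum in \<open>d_fun\<close> covers the two directions:
  \<open>1 + \<rho>'\<close> from optimality above,
  \<open>\<rho> * (1 + c_fun \<rho> \<rho>')\<close> from the event below.\<close>

lemma residual_error_le: "\<bar>r - e\<bar> \<le> lam / m * (d_fun \<rho> \<rho>' * q)"
proof -
  have q: "0 \<le> q" using p_le nuclear_norm_nonneg[of "P_par A \<Delta>"] by linarith
  have lm: "0 \<le> lam / m" using lam m_pos by simp
  have "nuclear_norm \<Gamma> - nuclear_norm G \<le> (1 + \<rho>') * q"
    using nuclear_norm_gap_le[of A] p_le gap_le nuclear_norm_nonneg[of "P_perp A \<Delta>"]
    by (simp add: algebra_simps)
  also have "\<dots> \<le> d_fun \<rho> \<rho>' * q"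
    using q by (intro mult_right_mono) (auto simp: d_fun_def)
  finally have "r - e \<le> lam / m * (d_fun \<rho> \<rho>' * q)"
    using residual_le mult_left_mono[OF _ lm] by (smt (verit))
  moreover have "e - r \<le> lam / m * (d_fun \<rho> \<rho>' * q)"
  proof -
    have "\<rho> * nuclear_norm \<Delta> \<le> \<rho> * ((1 + c_fun \<rho> \<rho>') * q)"
      using \<rho> nuclear_norm_error_le by (intro mult_left_mono) auto
    also have "\<dots> = \<rho> * (1 + c_fun \<rho> \<rho>') * q" by simp
    also have "\<dots> \<le> d_fun \<rho> \<rho>' * q"
      using q by (intro mult_right_mono) (auto simp: d_fun_def)
    finally have "lam / m * (\<rho> * nuclear_norm \<Delta>) \<le> lam / m * (d_fun \<rho> \<rho>' * q)"
      using lm by (rule mult_left_mono)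
    then show ?thesis using residual_ge by (simp add: algebra_simps)
  qed
  ultimately show ?thesis by linarith
qed

text \<open>Expand the square of the residual \<open>M_X \<X> E - M_X \<X> \<Delta>\<close> and
  write its excess over the squared \<open>e\<close> as \<open>2 * e * (r - e)\<close> plus a
  square. The noise term and the linear term add up to \<open>e_fun\<close>.\<close>

lemma norm_M_X_error_power2_le:
  "(norm (M_X \<X> \<Delta>))\<^sup>2
     \<le> 2 * e * (lam / m) * e_fun \<rho> \<rho>' * q + (lam / m * (d_fun \<rho> \<rho>' * q))\<^sup>2"
proof -
  let ?b = "lam / m * (d_fun \<rho> \<rho>' * q)"
  have "r\<^sup>2 = e\<^sup>2 - 2 * (M_X \<X> E \<bullet> \<Delta>) + (norm (M_X \<X> \<Delta>))\<^sup>2"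
    unfolding r_def M_residual e_def inner_M_X[of \<X> E \<Delta>]
    by (simp add: inner_diff_left inner_diff_right inner_commute flip: dot_square_norm)
  then have "(norm (M_X \<X> \<Delta>))\<^sup>2 = 2 * (M_X \<X> E \<bullet> \<Delta>) + 2 * e * (r - e) + (r - e)\<^sup>2"
    by (simp add: power2_eq_square algebra_simps)
  also have "\<dots> \<le> 2 * (e * (\<rho> * lam / m * ((1 + c_fun \<rho> \<rho>') * q))) + 2 * e * ?b + ?b\<^sup>2"
  proof (intro add_mono)
    have "M_X \<X> E \<bullet> \<Delta> \<le> e * (\<rho> * lam / m * nuclear_norm \<Delta>)" using inner_E_le by simp
    also have "\<dots> \<le> e * (\<rho> * lam / m * ((1 + c_fun \<rho> \<rho>') * q))"
      using \<rho> lam m_pos e_nonneg nuclear_norm_error_le by (intro mult_left_mono) auto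
    finally show "2 * (M_X \<X> E \<bullet> \<Delta>) \<le> 2 * (e * (\<rho> * lam / m * ((1 + c_fun \<rho> \<rho>') * q)))" by simp
    show "2 * e * (r - e) \<le> 2 * e * ?b"
      using residual_error_le e_nonneg by (intro mult_left_mono) auto
    show "(r - e)\<^sup>2 \<le> ?b\<^sup>2"
      using residual_error_le by (rule power2_le_iff_abs_le[THEN iffD2, rotated]) (use residual_error_le in linarith)
  qed
  also have "\<dots> = 2 * e * (lam / m) * e_fun \<rho> \<rho>' * q + ?b\<^sup>2"
    by (simp add: e_fun_def algebra_simps add_divide_distrib)
  finally show ?thesis .
qed

end

end

section \<open>Compatibility constant and oracle bounds\<close>

lemma rank_eq_0_imp_eq_0:
  fixes A :: "real^'t^'n"
  assumes "rank A = 0" shows "A = 0"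
proof -
  have "rows A \<subseteq> {0}" using assms by (simp add: row_rank_def)
  then have "row i A = 0" for i by (auto simp: rows_def)
  then show ?thesis by (simp add: row_def vec_eq_iff)
qed

lemma d_fun_pos: "\<rho>' > 0 \<Longrightarrow> 0 < d_fun \<rho> \<rho>'"
  by (simp add: d_fun_def)

lemma c_fun_pos: "0 < \<rho> \<Longrightarrow> \<rho> < 1 \<Longrightarrow> \<rho>' > 0 \<Longrightarrow> 0 < c_fun \<rho> \<rho>'"
  by (simp add: c_fun_def)

lemma e_fun_pos: "0 < \<rho> \<Longrightarrow> \<rho> < 1 \<Longrightarrow> \<rho>' > 0 \<Longrightarrow> 0 < e_fun \<rho> \<rho>'"
  by (simp add: e_fun_def add_pos_pos d_fun_pos c_fun_pos)

text \<open>If the \<open>P_par\<close> part vanished, the cone condition would kill the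
  \<open>P_perp\<close> part as well. This makes the quotient in \<open>compat\<close> a genuine
  one.\<close>

lemma P_par_pos_of_cone:
  assumes "\<Delta> \<in> cone_set A c" "\<Delta> \<noteq> 0"
  shows "0 < nuclear_norm (P_par A \<Delta>)" and "0 < rank A"
proof -
  show pos: "0 < nuclear_norm (P_par A \<Delta>)"
  proof (rule ccontr)
    assume "\<not> ?thesis"
    then have "P_par A \<Delta> = 0" using nuclear_norm_nonneg[of "P_par A \<Delta>"] by (simp add: less_le)
    moreover from this have "P_perp A \<Delta> = 0"
      using assms(1) nuclear_norm_nonneg[of "P_perp A \<Delta>"] by (simp add: cone_set_def)
    ultimately show False using assms(2) by (simp add: P_par_def)
  qed
  show "0 < rank A"
    using pos rank_eq_0_imp_eq_0[of A] by (cases "rank A = 0") (auto simp: P_par_def)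
qed

text \<open>The quotient at \<open>\<Delta>\<close> bounds the infimum, so the constant is finite
  and can be handled as a real number.\<close>

lemma compat_of_cone:
  assumes \<Delta>: "\<Delta> \<in> cone_set A c" "\<Delta> \<noteq> 0"
  obtains k where "compat \<X> A c = ereal k" "0 \<le> k"
    "k * nuclear_norm (P_par A \<Delta>) \<le> sqrt (2 * real (rank A)) * norm (M_X \<X> \<Delta>)"
proof -
  have le: "compat \<X> A c
      \<le> ereal (sqrt (2 * real (rank A)) * norm (M_X \<X> \<Delta>) / nuclear_norm (P_par A \<Delta>))"
    unfolding compat_def using \<Delta> by (intro INF_lower) auto
  have ge: "0 \<le> compat \<X> A c"
    unfolding compat_def by (intro INF_greatest) (simp add: nuclear_norm_nonneg)
  obtain k where k: "compat \<X> A c = ereal k"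
    using le ge by (cases "compat \<X> A c") auto
  then show ?thesis
    using that[OF k] le ge P_par_pos_of_cone(1)[OF \<Delta>] by (simp add: field_simps)
qed

lemma undef_inf_times_infinity: "0 \<le> x \<Longrightarrow> undef_inf_times \<infinity> x = \<infinity>"
  by (cases x) (auto simp: undef_inf_times_def)

lemma theta_inf_finite:
  fixes A :: "real^'t^'n"
  assumes "compat \<X> A (c_fun \<rho> \<rho>') = ereal k" and "k > 0"
    and "(d_fun \<rho> \<rho>' * sqrt (2 * real (rank A)) * lam / (sqrt_NT TYPE(real^'t^'n) * k))\<^sup>2 < 1"
  shows "theta_inf \<X> lam A \<rho> \<rho>' =
    ereal (2 / (1 - (d_fun \<rho> \<rho>' * sqrt (2 * real (rank A)) * lam / (sqrt_NT TYPE(real^'t^'n) * k))\<^sup>2)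
      * e_fun \<rho> \<rho>')"
proof -
  define z where "z = d_fun \<rho> \<rho>' * sqrt (2 * real (rank A)) * lam / (sqrt_NT TYPE(real^'t^'n) * k)"
  have z: "z\<^sup>2 < 1" using assms(3) by (simp add: z_def)
  have "ereal (d_fun \<rho> \<rho>' * sqrt (2 * real (rank A)) * lam) /
      (ereal (sqrt_NT TYPE(real^'t^'n)) * compat \<X> A (c_fun \<rho> \<rho>')) = ereal z"
    using assms(2) sqrt_NT_pos[where 't='t and 'n='n] by (simp add: assms(1) z_def)
  then have "theta_inf \<X> lam A \<rho> \<rho>' = 2 * inverse (max 0 (1 - (ereal z)\<^sup>2)) * ereal (e_fun \<rho> \<rho>')"
    by (simp only: theta_inf_def)
  also have "max 0 (1 - (ereal z)\<^sup>2) = ereal (1 - z\<^sup>2)"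
    using z by (simp add: one_ereal_def max_def)
  also have "2 * inverse (ereal (1 - z\<^sup>2)) * ereal (e_fun \<rho> \<rho>') = ereal (2 / (1 - z\<^sup>2) * e_fun \<rho> \<rho>')"
    using z by (simp add: divide_inverse)
  finally show ?thesis by (simp add: z_def)
qed

text \<open>The truncated bracket is 0, so its inverse is infinite. For \<open>k = 0\<close> the
  inner quotient is itself infinite, as positive rank makes its numerator positive.\<close>

lemma theta_inf_infinite:
  fixes A :: "real^'t^'n"
  assumes "0 < \<rho>" "\<rho> < 1" "\<rho>' > 0" "lam > 0" "0 < rank A"
    and k: "compat \<X> A (c_fun \<rho> \<rho>') = ereal k" "0 \<le> k"
    and z: "k = 0 \<or>
      1 \<le> (d_fun \<rho> \<rho>' * sqrt (2 * real (rank A)) * lam / (sqrt_NT TYPE(real^'t^'n) * k))\<^sup>2"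
  shows "theta_inf \<X> lam A \<rho> \<rho>' = \<infinity>"
proof -
  let ?a = "d_fun \<rho> \<rho>' * sqrt (2 * real (rank A)) * lam"
  define Q where "Q = ereal ?a / (ereal (sqrt_NT TYPE(real^'t^'n)) * compat \<X> A (c_fun \<rho> \<rho>'))"
  have a: "?a > 0" using assms by (simp add: d_fun_pos)
  have "1 \<le> Q\<^sup>2"
  proof (cases "k = 0")
    case True
    then have "Q = \<infinity>" using a assms d_fun_pos[OF assms(3), of \<rho>]
      by (auto simp: Q_def k divide_ereal_def simp flip: zero_ereal_def)
    then show ?thesis by (simp add: power2_eq_square)
  next
    case False
    then have "Q = ereal (?a / (sqrt_NT TYPE(real^'t^'n) * k))"
      using sqrt_NT_pos[where 't='t and 'n='n] by (simp add: Q_def k)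
    then show ?thesis using z False by (simp add: one_ereal_def)
  qed
  then have "1 - Q\<^sup>2 \<le> 0"
    by (cases "Q\<^sup>2") (auto simp: one_ereal_def)
  then have "max 0 (1 - Q\<^sup>2) = 0" by simp
  then have "theta_inf \<X> lam A \<rho> \<rho>' = 2 * inverse 0 * ereal (e_fun \<rho> \<rho>')"
    by (simp only: theta_inf_def flip: Q_def)
  then show ?thesis
    using e_fun_pos[OF assms(1-3)] by simp
qed

lemma undef_inf_div_ge_0: "0 \<le> a \<Longrightarrow> 0 \<le> k \<Longrightarrow> 0 < m \<Longrightarrow>
  0 \<le> undef_inf_div (ereal a) (ereal m * (ereal k)\<^sup>2)"
  by (auto simp: undef_inf_div_def divide_ereal_def)

text \<open>Moves a positive constant to the real side of a bound that may be infinite.\<close>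

lemma ereal_le_times_of_divide_le:
  assumes "k > 0" "ereal (x / k) \<le> y"
  shows "ereal x \<le> ereal k * y"
  using assms by (cases y) (auto simp: field_simps)

section \<open>Oracle bounds and passage to the infima\<close>

context sqrt_lasso_event
begin

text \<open>Stated with \<open>q / 2\<close> because the approximation term of \<open>theta\<close>
  is half of the threshold \<open>2 * nuclear_norm (\<Gamma> - A) / \<rho>'\<close>.\<close>

lemma theta_dominates:
  assumes \<rho>': "\<rho>' > 0"
  obtains q where "nuclear_norm \<Delta> \<le> (1 + c_fun \<rho> \<rho>') * q"
    and "\<bar>r - e\<bar> \<le> lam / m * (d_fun \<rho> \<rho>' * q)"
    and "ereal (q / 2)
      \<le> max (undef_inf_times (theta_inf \<X> lam A \<rho> \<rho>')
            (undef_inf_div (ereal (lam * real (rank A) * e))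
               (ereal m * (compat \<X> A (c_fun \<rho> \<rho>'))\<^sup>2)))
         (ereal (1 / \<rho>' * nuclear_norm (\<Gamma> - A)))"
proof -
  let ?p = "nuclear_norm (P_par A \<Delta>)" and ?g = "nuclear_norm (\<Gamma> - A)"
  define q where "q = max ?p (2 * ?g / \<rho>')"
  have p_le: "?p \<le> q" by (simp add: q_def)
  have gap_le: "2 * ?g \<le> \<rho>' * q"
    using \<rho>' by (simp add: q_def field_simps max_def)
  note bounds = \<rho>' p_le gap_le
  have "ereal (q / 2)
      \<le> max (undef_inf_times (theta_inf \<X> lam A \<rho> \<rho>')
            (undef_inf_div (ereal (lam * real (rank A) * e))
               (ereal m * (compat \<X> A (c_fun \<rho> \<rho>'))\<^sup>2)))
         (ereal (1 / \<rho>' * ?g))"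
  proof (cases "?p \<le> 2 * ?g / \<rho>'")
    case True
    then have "q / 2 = 1 / \<rho>' * ?g" by (simp add: q_def)
    then show ?thesis by simp
  next
    case False
    then have qp: "q = ?p" by (simp add: q_def)
    have p: "?p > 0"
      using False \<rho>' nuclear_norm_nonneg[of "\<Gamma> - A"] by (smt (verit) divide_nonneg_pos)
    have ne: "\<Delta> \<noteq> 0" using p by auto
    have cone: "\<Delta> \<in> cone_set A (c_fun \<rho> \<rho>')"
      using nuclear_norm_P_perp_le[OF bounds] by (simp add: cone_set_def qp)
    obtain k where k: "compat \<X> A (c_fun \<rho> \<rho>') = ereal k" "0 \<le> k"
      and kp: "k * ?p \<le> sqrt (2 * real (rank A)) * norm (M_X \<X> \<Delta>)"
      by (rule compat_of_cone[OF cone ne])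
    have rank: "0 < rank A" by (rule P_par_pos_of_cone(2)[OF cone ne])
    \<comment> \<open>The quotient that is squared inside \<open>theta_inf\<close>.\<close>
    define z where "z = d_fun \<rho> \<rho>' * sqrt (2 * real (rank A)) * lam / (m * k)"
    have "ereal (?p / 2)
      \<le> undef_inf_times (theta_inf \<X> lam A \<rho> \<rho>')
            (undef_inf_div (ereal (lam * real (rank A) * e)) (ereal m * (ereal k)\<^sup>2))"
    proof (cases "k = 0 \<or> 1 \<le> z\<^sup>2")
      case True
      then have "theta_inf \<X> lam A \<rho> \<rho>' = \<infinity>"
        using \<rho> \<rho>' lam rank k by (intro theta_inf_infinite) (auto simp: z_def m_def)
      then show ?thesis
        using undef_inf_div_ge_0[of "lam * real (rank A) * e" k m] lam k(2) m_pos e_nonneg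
        by (simp add: undef_inf_times_infinity)
    next
      case False
      then have k_pos: "k > 0" and z: "z\<^sup>2 < 1" using k(2) by auto
      let ?T = "2 / (1 - z\<^sup>2) * e_fun \<rho> \<rho>'"
      have \<theta>: "theta_inf \<X> lam A \<rho> \<rho>' = ereal ?T"
        using theta_inf_finite[OF k(1) k_pos] z by (simp add: z_def m_def)
      \<comment> \<open>A nonzero denominator excludes the undefined expressions, so everything is
        real arithmetic.\<close>
      have "m * k\<^sup>2 \<noteq> 0" using m_pos k_pos by simp
      then have rhs: "undef_inf_times (theta_inf \<X> lam A \<rho> \<rho>')
            (undef_inf_div (ereal (lam * real (rank A) * e)) (ereal m * (ereal k)\<^sup>2))
          = ereal (?T * (lam * real (rank A) * e / (m * k\<^sup>2)))"
        by (simp add: \<theta> undef_inf_times_def undef_inf_div_def)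
      have "(k * ?p)\<^sup>2 \<le> (sqrt (2 * real (rank A)) * norm (M_X \<X> \<Delta>))\<^sup>2"
        using kp k_pos p by (intro power_mono) auto
      also have "\<dots> = 2 * real (rank A) * (norm (M_X \<X> \<Delta>))\<^sup>2"
        by (simp add: power_mult_distrib)
      also have "\<dots> \<le> 2 * real (rank A) *
          (2 * e * (lam / m) * e_fun \<rho> \<rho>' * ?p + (lam / m * (d_fun \<rho> \<rho>' * ?p))\<^sup>2)"
        using norm_M_X_error_power2_le[OF bounds] by (intro mult_left_mono) (auto simp: qp)
      \<comment> \<open>By the choice of \<open>z\<close> the quadratic term is a multiple
        \<open>z\<^sup>2\<close> of the left-hand side. It is absorbed there since
        \<open>z\<^sup>2 < 1\<close>, and one factor \<open>?p\<close> then cancels.\<close>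
      also have "\<dots> = ?p * (4 * real (rank A) * e * (lam / m) * e_fun \<rho> \<rho>') + z\<^sup>2 * (k * ?p)\<^sup>2"
        using k_pos m_pos by (simp add: z_def power_mult_distrib power_divide field_simps)
      finally have "?p * (?p * k\<^sup>2 * (1 - z\<^sup>2)) \<le> ?p * (4 * real (rank A) * e * (lam / m) * e_fun \<rho> \<rho>')"
        by (simp add: power_mult_distrib power2_eq_square algebra_simps)
      then have "?p * k\<^sup>2 * (1 - z\<^sup>2) \<le> 4 * real (rank A) * e * (lam / m) * e_fun \<rho> \<rho>'"
        using p by (simp only: mult_le_cancel_left_pos)
      moreover have "0 < k\<^sup>2 * (1 - z\<^sup>2)" using k_pos z by simp
      ultimately have "?p \<le> 4 * real (rank A) * e * (lam / m) * e_fun \<rho> \<rho>' / (k\<^sup>2 * (1 - z\<^sup>2))"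
        by (simp only: pos_le_divide_eq mult.assoc)
      then have "?p / 2 \<le> 4 * real (rank A) * e * (lam / m) * e_fun \<rho> \<rho>' / (k\<^sup>2 * (1 - z\<^sup>2)) / 2"
        by (rule divide_right_mono) simp
      also have "\<dots> = ?T * (lam * real (rank A) * e / (m * k\<^sup>2))"
        by (simp add: mult_ac)
      finally show ?thesis by (simp only: rhs ereal_less_eq)
    qed
    then show ?thesis by (simp add: k(1) qp le_max_iff_disj)
  qed
  then show ?thesis
    using that nuclear_norm_error_le[OF bounds] residual_error_le[OF bounds] by blast
qed

text \<open>The \<open>q\<close> of \<open>theta_dominates\<close> depends on \<open>A\<close>. A
  target \<open>x\<close> below every admissible \<open>q / 2\<close> does not, so it survives the
  infimum over \<open>A\<close>.\<close>

lemma le_theta: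
  assumes "\<rho>' > 0"
    and "\<And>q. nuclear_norm \<Delta> \<le> (1 + c_fun \<rho> \<rho>') * q \<Longrightarrow>
      \<bar>r - e\<bar> \<le> lam / m * (d_fun \<rho> \<rho>' * q) \<Longrightarrow> x \<le> q / 2"
  shows "ereal x \<le> theta \<X> lam \<Gamma> E \<rho> \<rho>'"
  unfolding theta_def
proof (rule INF_greatest)
  fix A :: "real^'t^'n"
  obtain q where "x \<le> q / 2" and "ereal (q / 2)
      \<le> max (undef_inf_times (theta_inf \<X> lam A \<rho> \<rho>')
            (undef_inf_div (ereal (lam * real (rank A) * e))
               (ereal m * (compat \<X> A (c_fun \<rho> \<rho>'))\<^sup>2)))
         (ereal (1 / \<rho>' * nuclear_norm (\<Gamma> - A)))"
    using theta_dominates[OF assms(1), of A] assms(2) by metis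
  then show "ereal x
      \<le> max (undef_inf_times (theta_inf \<X> lam A \<rho> \<rho>')
            (undef_inf_div (ereal (lam * real (rank A) * norm (M_X \<X> E)))
               (ereal (sqrt_NT TYPE(real^'t^'n)) * (compat \<X> A (c_fun \<rho> \<rho>'))\<^sup>2)))
         (ereal (1 / \<rho>' * nuclear_norm (\<Gamma> - A)))"
    unfolding e_def m_def by (meson ereal_less_eq(3) order_trans)
qed

lemma nuclear_norm_error_le_theta_star:
  "ereal (nuclear_norm (G - \<Gamma>)) \<le> 2 * theta_star \<X> lam \<Gamma> E \<rho>"
proof -
  have "ereal (nuclear_norm \<Delta> / 2) \<le> theta_star \<X> lam \<Gamma> E \<rho>"
    unfolding theta_star_def
  proof (rule INF_greatest)
    fix \<rho>' :: real assume "\<rho>' \<in> {0<..}"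
    then have \<rho>': "\<rho>' > 0" by simp
    then have c: "1 + c_fun \<rho> \<rho>' > 0" using c_fun_pos[OF \<rho>] by (simp add: add_pos_pos)
    show "ereal (nuclear_norm \<Delta> / 2) \<le> ereal (1 + c_fun \<rho> \<rho>') * theta \<X> lam \<Gamma> E \<rho> \<rho>'"
      by (intro ereal_le_times_of_divide_le le_theta c \<rho>') (use c in \<open>simp add: field_simps\<close>)
  qed
  then have "ereal (nuclear_norm \<Delta>) \<le> ereal 2 * theta_star \<X> lam \<Gamma> E \<rho>"
    by (intro ereal_le_times_of_divide_le) auto
  then show ?thesis by (simp add: \<Delta>_def)
qed

lemma residual_error_le_theta_sigma:
  "ereal \<bar>norm (M_X \<X> (\<Gamma> + E - G)) / sqrt_NT TYPE(real^'t^'n)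
       - norm (M_X \<X> E) / sqrt_NT TYPE(real^'t^'n)\<bar>
    \<le> ereal (2 * lam / (real CARD('n) * real CARD('t))) * theta_sigma \<X> lam \<Gamma> E \<rho>"
proof -
  have "ereal (\<bar>r / m - e / m\<bar> / (2 * lam / m\<^sup>2)) \<le> theta_sigma \<X> lam \<Gamma> E \<rho>"
    unfolding theta_sigma_def
  proof (rule INF_greatest)
    fix \<rho>' :: real assume "\<rho>' \<in> {0<..}"
    then have \<rho>': "\<rho>' > 0" by simp
    then have d: "d_fun \<rho> \<rho>' > 0" by (rule d_fun_pos)
    \<comment> \<open>In this form the bound \<open>lam / m * (d_fun \<rho> \<rho>' * q)\<close> on
      \<open>\<bar>r - e\<bar>\<close> becomes exactly
      \<open>d_fun \<rho> \<rho>' * (q / 2)\<close>.\<close>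
    have eq: "\<bar>r / m - e / m\<bar> / (2 * lam / m\<^sup>2) = \<bar>r - e\<bar> * m / (2 * lam)"
      using m_pos by (simp add: power2_eq_square flip: diff_divide_distrib)
    show "ereal (\<bar>r / m - e / m\<bar> / (2 * lam / m\<^sup>2)) \<le> ereal (d_fun \<rho> \<rho>') * theta \<X> lam \<Gamma> E \<rho> \<rho>'"
      unfolding eq
      by (intro ereal_le_times_of_divide_le le_theta d \<rho>') (use d lam m_pos in \<open>simp add: field_simps\<close>)
  qed
  then have "ereal \<bar>r / m - e / m\<bar> \<le> ereal (2 * lam / m\<^sup>2) * theta_sigma \<X> lam \<Gamma> E \<rho>"
    using lam m_pos by (intro ereal_le_times_of_divide_le) auto
  then show ?thesis by (simp add: r_def e_def m_def sqrt_NT_power2)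
qed

end

theorem theorem1:
  fixes M :: "'w measure"
    and K :: nat
    and X :: "nat \<Rightarrow> 'w \<Rightarrow> real^'t^'n"
    and \<Gamma> E Y :: "'w \<Rightarrow> real^'t^'n"
    and \<beta> :: "nat \<Rightarrow> real"
    and beta_hat :: "'w \<Rightarrow> nat \<Rightarrow> real"
    and Gamma_hat :: "'w \<Rightarrow> real^'t^'n"
    and sigma_hat :: "'w \<Rightarrow> real"
    and lam \<rho> :: real
    and event :: "'w set"
  assumes "prob_space M"
    and "\<And>k. k \<in> {1..K} \<Longrightarrow> X k \<in> borel_measurable M"
    and "\<Gamma> \<in> borel_measurable M"
    and "E \<in> borel_measurable M"
    and "\<And>\<omega>. \<omega> \<in> space M \<Longrightarrow> Y \<omega> = (\<Sum>k=1..K. \<beta> k *\<^sub>R X k \<omega>) + \<Gamma> \<omega> + E \<omega>"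
    and "lam > 0"
    and "\<And>\<omega>. \<omega> \<in> space M \<Longrightarrow>
           is_arg_min (objective K (\<lambda>k. X k \<omega>) (Y \<omega>) lam) (\<lambda>_. True) (beta_hat \<omega>, Gamma_hat \<omega>)"
    and "\<And>\<omega>. \<omega> \<in> space M \<Longrightarrow>
           sigma_hat \<omega> = scaled_residual K (\<lambda>k. X k \<omega>) (Y \<omega>) (beta_hat \<omega>) (Gamma_hat \<omega>)"
    and "0 < \<rho>" and "\<rho> < 1"
    and "event = {\<omega> \<in> space M.
           \<rho> * lam * (norm (M_X ((\<lambda>k. X k \<omega>) ` {1..K}) (E \<omega>)) / sqrt_NT TYPE(real^'t^'n))
             \<ge> op_norm (M_X ((\<lambda>k. X k \<omega>) ` {1..K}) (E \<omega>))}"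
  shows "\<forall>\<omega>\<in>event.
      ereal (nuclear_norm (Gamma_hat \<omega> - \<Gamma> \<omega>))
        \<le> 2 * theta_star ((\<lambda>k. X k \<omega>) ` {1..K}) lam (\<Gamma> \<omega>) (E \<omega>) \<rho>
    \<and> ereal \<bar>sigma_hat \<omega> -
          norm (M_X ((\<lambda>k. X k \<omega>) ` {1..K}) (E \<omega>)) / sqrt_NT TYPE(real^'t^'n)\<bar>
        \<le> ereal (2 * lam / (real CARD('n) * real CARD('t)))
          * theta_sigma ((\<lambda>k. X k \<omega>) ` {1..K}) lam (\<Gamma> \<omega>) (E \<omega>) \<rho>"
proof
  fix \<omega> assume \<omega>: "\<omega> \<in> event"
  let ?\<X> = "(\<lambda>k. X k \<omega>) ` {1..K}"
  have space: "\<omega> \<in> space M" using \<omega> assms(11) by simp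
  have lc: "(\<Sum>k=1..K. \<beta> k *\<^sub>R X k \<omega>) \<in> span ?\<X>"
    by (intro span_sum span_scale span_base imageI)
  \<comment> \<open>The true regression part lies in the span of the regressors, so
    \<open>M_X\<close> removes it from \<open>Y\<close>.\<close>
  have M_Y: "M_X ?\<X> (Y \<omega> - G) = M_X ?\<X> (\<Gamma> \<omega> + E \<omega> - G)" for G
    unfolding assms(5)[OF space]
    by (simp only: linear_diff[OF linear_M_X] linear_add[OF linear_M_X] M_X_eq_0[OF lc] add_0)
  note profile = arg_min_objective_profile[OF assms(7)[OF space], unfolded M_Y]
  interpret sqrt_lasso_event ?\<X> "\<Gamma> \<omega>" "E \<omega>" "Gamma_hat \<omega>" lam \<rho>
  proof
    show "norm (M_X ?\<X> (\<Gamma> \<omega> + E \<omega> - Gamma_hat \<omega>)) / sqrt_NT TYPE(real^'t^'n)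
         + lam / (real CARD('n) * real CARD('t)) * nuclear_norm (Gamma_hat \<omega>)
       \<le> norm (M_X ?\<X> (E \<omega>)) / sqrt_NT TYPE(real^'t^'n)
         + lam / (real CARD('n) * real CARD('t)) * nuclear_norm (\<Gamma> \<omega>)"
      using profile(2)[of "\<Gamma> \<omega>"] by simp
    show "op_norm (M_X ?\<X> (E \<omega>))
        \<le> \<rho> * lam * (norm (M_X ?\<X> (E \<omega>)) / sqrt_NT TYPE(real^'t^'n))"
      using \<omega> assms(11) by simp
  qed (use assms in auto)
  have "sigma_hat \<omega> = norm (M_X ?\<X> (\<Gamma> \<omega> + E \<omega> - Gamma_hat \<omega>)) / sqrt_NT TYPE(real^'t^'n)"
    by (simp only: assms(8)[OF space] scaled_residual_def profile(1)) simp
  then show "ereal (nuclear_norm (Gamma_hat \<omega> - \<Gamma> \<omega>)) \<le> 2 * theta_star ?\<X> lam (\<Gamma> \<omega>) (E \<omega>) \<rho>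
    \<and> ereal \<bar>sigma_hat \<omega> - norm (M_X ?\<X> (E \<omega>)) / sqrt_NT TYPE(real^'t^'n)\<bar>
        \<le> ereal (2 * lam / (real CARD('n) * real CARD('t)))
          * theta_sigma ?\<X> lam (\<Gamma> \<omega>) (E \<omega>) \<rho>"
    using nuclear_norm_error_le_theta_star residual_error_le_theta_sigma by simp
qed

end
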